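(* Let $\epsilon\in\{1,-1\}$ and let $(X,J)\in\mathbb{C}^{n\times 2n}\times\mathbb{C}^{2n\times 2n}$, where $J$ is of the palindromic Jordan canonical form (PJCF) and $\begin{bmatrix}X\\-XJ^{-1}\end{bmatrix}$ is nonsingular. Assume that each distinct eigenvalue of $J$ has geometric multiplicity one. Suppose there are two nonsingular matrices $S,\widetilde S\in\mathbb{S}_{(X,J)}$ such that $\zeta_n(\widetilde SS^{-1})=(n_1,n_2,\dots,n_{\hat t})$. Then for any nonsingular $\widehat S\in\mathbb{S}_{(X,J)}$ there exists a nonsingular $K\in\mathbb{C}^{n\times n}$ such that $$K^{\star}\widehat Q(\lambda)K=\mathrm{diag}(Q_1(\lambda),\dots,Q_{\hat t}(\lambda)),$$ where $\widehat Q(\lambda)=\lambda^2\widehat A_1^{\star}+\lambda\widehat A_0+\epsilon\widehat A_1$ is the regular $\star$-(anti)-palindromic system with $$\widehat A_1=\epsilon\,(XJ^{-1}\widehat SX^{\star})^{-1},\qquad \widehat A_0=-\widehat A_1XJ^{-2}\widehat SX^{\star}\widehat A_1,$$ and for $i=1,\dots,\hat t$, $Q_i(\lambda)$ is a regular $\star$-(anti)-palindromic system (with the same $\star$ and $\epsilon$) of order $n_i$. Furthermore, $K$ can be chosen independently of $\widehat S$ (the same $K$ works for all nonsingular $\widehat S\in\mathbb{S}_{(X,J)}$).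
   Context: The symbol $\star$ denotes one fixed operation, either the transpose $\top$ or the conjugate transpose $*$ (for complex matrices); for a scalar, $\mu^{\star}=\mu$ if $\star=\top$ and $\mu^{\star}=\bar\mu$ if $\star=*$. A $\star$-(anti)-palindromic system of order $m$ is $Q(\lambda)=\lambda^2A_1^{\star}+\lambda A_0+\epsilon A_1$ with $A_1,A_0\in\mathbb{C}^{m\times m}$, $A_0^{\star}=\epsilon A_0$; it is regular if $A_1$ is nonsingular. $\mathbb{S}_J=\{S\in\mathbb{C}^{2n\times 2n}: S^{\star}=-\epsilon S,\ S=JSJ^{\star}\}$ and $\mathbb{S}_{(X,J)}=\{S\in\mathbb{S}_J: XSX^{\star}=0\}$. PJCF: $J=\mathrm{diag}(J_1,\dots,J_t)\in\mathbb{C}^{2n\times 2n}$, where $J_i=\lambda_iI_{n_i'}+\mathrm{diag}(N_{i1},\dots,N_{im_i})$, each $N_{ij}$ is the nilpotent matrix of some order $n_{ij}$ with ones on the superdiagonal and zeros elsewhere, $n_{i1}\ge\dots\ge n_{im_i}$, $\sum_j n_{ij}=n_i'$, $\sum_i n_i'=2n$; the $\lambda_i$ are distinct and nonzero and, for some $\ell$ with $2\ell\le t$: for $i=1,\dots,\ell$, $\lambda_{2i}=1/\lambda_{2i-1}^{\star}$, $|\lambda_{2i-1}|\le1$, $m_{2i-1}=m_{2i}$ and $n_{2i-1,j}=n_{2i,j}$ for all $j$; for $i=2\ell+1,\dots,t$, $\lambda_i=\pm1$ if $\star=\top$ and $|\lambda_i|=1$ if $\star=*$. Geometric multiplicity one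 means $m_i=1$ for all $i$, i.e. each $J_i$ is a single Jordan block. $\zeta_n$: for nonsingular $S,\widetilde S\in\mathbb{S}_{(X,J)}$ the eigenvalues of $\widetilde SS^{-1}$ come in pairs $(\mu,\mu^{\star})$, where $\mu$ and $\mu^\star$ have equal algebraic multiplicity if $\mu\neq\mu^{\star}$, and $\mu$ has even algebraic multiplicity if $\mu=\mu^{\star}$. List the distinct unordered pairs $\{\mu_i,\mu_i^{\star}\}$, $i=1,\dots,\hat t$ (a pair reduces to a single value if $\mu_i=\mu_i^{\star}$); let $n_i$ be the algebraic multiplicity of $\mu_i$ if $\mu_i\ne\mu_i^{\star}$ and half the algebraic multiplicity of $\mu_i$ if $\mu_i=\mu_i^{\star}$. Then $\zeta_n(\widetilde SS^{-1})=(n_1,\dots,n_{\hat t})$, which is a partition of $n$ (in some order). *)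

theory Defs
  imports
    "Jordan_Normal_Form.Jordan_Normal_Form"
    "Jordan_Normal_Form.Schur_Decomposition"
    "Jordan_Normal_Form.Gauss_Jordan_Elimination"
begin

datatype star_op = Transpose | Conj_Transpose

fun mstar :: "star_op \<Rightarrow> complex mat \<Rightarrow> complex mat" where
  "mstar Transpose A = transpose_mat A"
| "mstar Conj_Transpose A = mat_adjoint A"

fun sstar :: "star_op \<Rightarrow> complex \<Rightarrow> complex" where
  "sstar Transpose z = z"
| "sstar Conj_Transpose z = cnj z"

lemma mstar_dim [simp]:
  "dim_row (mstar st A) = dim_col A" "dim_col (mstar st A) = dim_row A"
  by (cases st; simp add: mat_adjoint_def)+

lemma mstar_index:
  assumes "i < dim_col A" "j < dim_row A"
  shows "mstar st A $$ (i, j) = sstar st (A $$ (j, i))"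
  using assms by (cases st) (auto simp: mat_adjoint_def mat_of_rows_def)

text \<open>Meaningful for nonsingular square matrices only; the value is unspecified otherwise.\<close>

definition mat_inv :: "complex mat \<Rightarrow> complex mat" where
  "mat_inv A = the (mat_inverse A)"

lemma mat_inv:
  assumes A: "A \<in> carrier_mat n n" and inv: "invertible_mat A"
  shows "mat_inv A \<in> carrier_mat n n" "A * mat_inv A = 1\<^sub>m n" "mat_inv A * A = 1\<^sub>m n"
proof -
  from inv A obtain B where B: "A * B = 1\<^sub>m n" "B * A = 1\<^sub>m (dim_row B)"
    unfolding invertible_mat_def inverts_mat_def by auto
  have "dim_col B = n" using B(1) by (metis index_mult_mat(3) index_one_mat(3))
  moreover have "dim_row B = n" using B(2) A
    by (metis carrier_matD(2) index_mult_mat(3) index_one_mat(3))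
  ultimately have "A \<in> Units (ring_mat TYPE(complex) n ())"
    using A B unfolding Units_def ring_mat_def by auto
  then obtain C where "mat_inverse A = Some C"
    using mat_inverse(1)[OF A, where b = "()"] by (cases "mat_inverse A") auto
  with mat_inverse(2)[OF A this]
  show "mat_inv A \<in> carrier_mat n n" "A * mat_inv A = 1\<^sub>m n" "mat_inv A * A = 1\<^sub>m n"
    unfolding mat_inv_def by auto
qed

definition pal_poly :: "star_op \<Rightarrow> complex \<Rightarrow> complex mat \<Rightarrow> complex mat \<Rightarrow> complex \<Rightarrow> complex mat" where
  "pal_poly st \<epsilon> A1 A0 z = z\<^sup>2 \<cdot>\<^sub>m mstar st A1 + z \<cdot>\<^sub>m A0 + \<epsilon> \<cdot>\<^sub>m A1"

definition pal_coeffs :: "star_op \<Rightarrow> complex \<Rightarrow> nat \<Rightarrow> complex mat \<Rightarrow> complex mat \<Rightarrow> bool" where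
  "pal_coeffs st \<epsilon> m A1 A0 \<longleftrightarrow>
     A1 \<in> carrier_mat m m \<and> A0 \<in> carrier_mat m m \<and> mstar st A0 = \<epsilon> \<cdot>\<^sub>m A0"

text \<open>\<open>Q\<close> is a regular system of order \<open>m\<close>, viewed as a function of the complex variable.\<close>

definition regular_pal_system :: "star_op \<Rightarrow> complex \<Rightarrow> nat \<Rightarrow> (complex \<Rightarrow> complex mat) \<Rightarrow> bool" where
  "regular_pal_system st \<epsilon> m Q \<longleftrightarrow>
     (\<exists>A1 A0. pal_coeffs st \<epsilon> m A1 A0 \<and> invertible_mat A1 \<and> Q = pal_poly st \<epsilon> A1 A0)"

text \<open>
  Jordan data: the list of the pairs \<open>(\<lambda>\<^sub>i, [n\<^sub>i\<^sub>1, n\<^sub>i\<^sub>2, \<dots>])\<close>, where the second component has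
  length \<open>m\<^sub>i\<close>.
\<close>

type_synonym jordan_data = "(complex \<times> nat list) list"

definition eig_block :: "complex \<Rightarrow> nat list \<Rightarrow> complex mat" where
  "eig_block l ns =
     l \<cdot>\<^sub>m 1\<^sub>m (sum_list ns) + diag_block_mat (map (\<lambda>k. jordan_block k 0) ns)"

definition jordan_data_mat :: "jordan_data \<Rightarrow> complex mat" where
  "jordan_data_mat bs = diag_block_mat (map (\<lambda>(l, ns). eig_block l ns) bs)"

text \<open>
  Lists are indexed from 0, so the reciprocal pair \<open>(\<lambda>\<^sub>2\<^sub>i\<^sub>-\<^sub>1, \<lambda>\<^sub>2\<^sub>i)\<close>, \<open>i = 1, \<dots>, r\<close>, sits at the
  positions \<open>2 * i\<close> and \<open>2 * i + 1\<close> with \<open>i < r\<close>.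
\<close>

definition pjcf_data :: "star_op \<Rightarrow> nat \<Rightarrow> jordan_data \<Rightarrow> bool" where
  "pjcf_data st n bs \<longleftrightarrow>
     (\<forall>(l, ns) \<in> set bs. ns \<noteq> [] \<and> 0 \<notin> set ns \<and> sorted_wrt (\<ge>) ns) \<and>
     (\<Sum>(l, ns) \<leftarrow> bs. sum_list ns) = 2 * n \<and>
     distinct (map fst bs) \<and> 0 \<notin> fst ` set bs \<and>
     (\<exists>r. 2 * r \<le> length bs \<and>
        (\<forall>i < r. fst (bs ! (2 * i + 1)) = 1 / sstar st (fst (bs ! (2 * i))) \<and>
                 cmod (fst (bs ! (2 * i))) \<le> 1 \<and>
                 snd (bs ! (2 * i)) = snd (bs ! (2 * i + 1))) \<and>
        (\<forall>i. 2 * r \<le> i \<and> i < length bs \<longrightarrow>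
           (case st of Transpose \<Rightarrow> fst (bs ! i) = 1 \<or> fst (bs ! i) = - 1
                     | Conj_Transpose \<Rightarrow> cmod (fst (bs ! i)) = 1)))"

definition S_J :: "star_op \<Rightarrow> complex \<Rightarrow> complex mat \<Rightarrow> complex mat set" where
  "S_J st \<epsilon> J = {S \<in> carrier_mat (dim_row J) (dim_row J).
     mstar st S = (- \<epsilon>) \<cdot>\<^sub>m S \<and> S = J * S * mstar st J}"

definition S_XJ :: "star_op \<Rightarrow> complex \<Rightarrow> complex mat \<Rightarrow> complex mat \<Rightarrow> complex mat set" where
  "S_XJ st \<epsilon> X J = {S \<in> S_J st \<epsilon> J. X * S * mstar st X = 0\<^sub>m (dim_row X) (dim_row X)}"

definition star_pair :: "star_op \<Rightarrow> complex \<Rightarrow> complex set" where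
  "star_pair st \<mu> = {\<mu>, sstar st \<mu>}"

text \<open>
  \<open>zeta_listing st M ns\<close>: for some listing \<open>\<mu>s\<close> of one representative of each of the distinct
  unordered pairs \<open>{\<mu>, \<mu>\<^sup>\<star>}\<close> of eigenvalues of \<open>M\<close>, \<open>ns\<close> is the list of the associated numbers
  \<open>n\<^sub>i\<close>.  The order of the pairs is arbitrary, so \<open>ns\<close> is determined by \<open>M\<close> up to permutation.
\<close>

definition zeta_listing :: "star_op \<Rightarrow> complex mat \<Rightarrow> nat list \<Rightarrow> bool" where
  "zeta_listing st M ns \<longleftrightarrow>
     (\<exists>\<mu>s. set \<mu>s \<subseteq> Collect (eigenvalue M) \<and>
           distinct (map (star_pair st) \<mu>s) \<and>
           star_pair st ` set \<mu>s = star_pair st ` Collect (eigenvalue M) \<and>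
           ns = map (\<lambda>\<mu>. if \<mu> \<noteq> sstar st \<mu> then Polynomial.order \<mu> (char_poly M)
                          else Polynomial.order \<mu> (char_poly M) div 2) \<mu>s)"

definition A1_hat :: "star_op \<Rightarrow> complex \<Rightarrow> complex mat \<Rightarrow> complex mat \<Rightarrow> complex mat \<Rightarrow> complex mat" where
  "A1_hat st \<epsilon> X J S = \<epsilon> \<cdot>\<^sub>m mat_inv (X * mat_inv J * S * mstar st X)"

definition A0_hat :: "star_op \<Rightarrow> complex \<Rightarrow> complex mat \<Rightarrow> complex mat \<Rightarrow> complex mat \<Rightarrow> complex mat" where
  "A0_hat st \<epsilon> X J S =
     - (A1_hat st \<epsilon> X J S * X * (mat_inv J ^\<^sub>m 2) * S * mstar st X * A1_hat st \<epsilon> X J S)"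

end

theory Submission
  imports Defs "Jordan_Normal_Form.Jordan_Normal_Form_Existence"
begin

text \<open>
  Write \<open>Z = X J\<^sup>-\<^sup>1\<close> and \<open>M = S' S\<^sup>-\<^sup>1\<close>. The relation \<open>S = J S J\<^sup>\<star>\<close> makes \<open>M\<close> commute with \<open>J\<close>, and since
  \<open>J\<close> is nonderogatory (one Jordan block per eigenvalue), all matrices that commute with \<open>J\<close> commute
  with each other (\<open>commutant_jordan_matrix_commutative\<close>).
  
  The space spanned by the columns of \<open>S X\<^sup>\<star>\<close> is the kernel of \<open>X\<close>, because \<open>X S X\<^sup>\<star> = 0\<close>. From this one
  finds a single \<open>n \<times> n\<close> matrix \<open>P\<close> with \<open>X M = P X\<close> and \<open>Z M = P Z\<close>
  (\<open>quotient_acts_as_scalar_block\<close>); thus \<open>M\<close> is similar to \<open>diag(P, P)\<close>, which explains why the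
  eigenvalues of \<open>M\<close> have even multiplicity. For every further \<open>R\<close> in the solution space, \<open>R S\<^sup>-\<^sup>1\<close>
  commutes with \<open>M\<close>, whence \<open>M R = R M\<^sup>\<star>\<close>. Compressing this identity with \<open>X\<close> and \<open>Z\<close> gives
  \<open>P B = B P\<^sup>\<star>\<close> for \<open>B = Z R X\<^sup>\<star>\<close> and \<open>P G = G P\<^sup>\<star>\<close> for \<open>G = Z J\<^sup>-\<^sup>1 R X\<^sup>\<star>\<close>. The coefficients of the system
  that belongs to \<open>R\<close> are \<open>\<epsilon> B\<^sup>-\<^sup>1\<close> and \<open>- B\<^sup>-\<^sup>1 G B\<^sup>-\<^sup>1\<close>, so both are matrices \<open>A\<close> with \<open>P\<^sup>\<star> A = A P\<close>
  (\<open>hat_system_intertwines\<close>), where \<open>P\<close> is independent of \<open>R\<close>.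
  
  Now let \<open>K\<close> bring \<open>P\<close> to a Jordan form \<open>D\<close> whose blocks are collected according to the pairs
  \<open>{\<mu>, \<mu>\<^sup>\<star>}\<close>. Then \<open>D\<^sup>\<star> (K\<^sup>\<star> A K) = (K\<^sup>\<star> A K) D\<close>, and an off-diagonal block \<open>Y\<close> of \<open>K\<^sup>\<star> A K\<close> satisfies
  \<open>D\<^sub>i\<^sup>\<star> Y = Y D\<^sub>j\<close> with \<open>D\<^sub>i\<^sup>\<star>\<close> and \<open>D\<^sub>j\<close> having no common eigenvalue, so \<open>Y = 0\<close> (\<open>intertwiner_eq_zero\<close>). Hence
  \<open>K\<close> block-diagonalizes all these systems at once. The order of the block for \<open>{\<mu>, \<mu>\<^sup>\<star>}\<close> is the joint
  multiplicity of \<open>\<mu>\<close> and \<open>\<mu>\<^sup>\<star>\<close> in \<open>P\<close>. Since \<open>P\<close> is similar to \<open>P\<^sup>\<star>\<close> through \<open>B\<close>, the two multiplicities agree,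
  and the order is the entry of \<open>\<zeta>\<^sub>n(M)\<close> that belongs to the pair (\<open>zeta_part_eq_group_size\<close>).
\<close>

section \<open>Matrix algebra\<close>

text \<open>
  The side conditions speak about dimensions only, so that the simplifier can discharge them and
  reassociate products of matrices of different formats.
\<close>

lemma mult_mat_assoc:
  fixes A B C :: "'a :: semiring_0 mat"
  assumes "dim_col A = dim_row B" "dim_col B = dim_row C"
  shows "A * B * C = A * (B * C)"
  using assms by (intro assoc_mult_mat) auto

lemma invertible_mat_iff_det:
  fixes A :: "'a :: field mat"
  assumes A: "A \<in> carrier_mat n n"
  shows "invertible_mat A \<longleftrightarrow> det A \<noteq> 0"
proof
  assume "invertible_mat A"
  then obtain B where B: "A * B = 1\<^sub>m n" "B * A = 1\<^sub>m (dim_row B)"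
    using A unfolding invertible_mat_def inverts_mat_def by auto
  have "B \<in> carrier_mat n n"
    by (metis A B carrier_matD carrier_matI index_mult_mat(2,3) index_one_mat(2,3))
  from det_mult[OF A this] B have "det A * det B = 1" by simp
  thus "det A \<noteq> 0" by auto
next
  assume "det A \<noteq> 0"
  from det_non_zero_imp_unit[OF A this, of "()"] show "invertible_mat A"
    using A unfolding Units_def ring_mat_def invertible_mat_def inverts_mat_def by auto
qed

text \<open>
  Injectivity is expressed by cancelling a matrix instead of a vector, because the cancellation laws
  for \<open>X\<close> and \<open>J\<close> below are statements about matrices.
\<close>

lemma invertible_matI:
  fixes A :: "'a :: field mat"
  assumes A: "A \<in> carrier_mat n n"
    and inj: "\<And>C. C \<in> carrier_mat n n \<Longrightarrow> A * C = 0\<^sub>m n n \<Longrightarrow> C = 0\<^sub>m n n"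
  shows "invertible_mat A"
proof -
  have "det A \<noteq> 0"
  proof
    assume "det A = 0"
    then obtain v where v: "v \<in> carrier_vec n" "v \<noteq> 0\<^sub>v n" "A *\<^sub>v v = 0\<^sub>v n"
      using det_0_iff_vec_prod_zero_field[OF A] by auto
    \<comment> \<open>A kernel vector, repeated to fill a square matrix.\<close>
    define C where "C = mat_of_cols n (replicate n v)"
    have C: "C \<in> carrier_mat n n" by (auto simp: C_def)
    have "A * C = 0\<^sub>m n n"
    proof (rule eq_matI)
      fix i j assume ij: "i < dim_row (0\<^sub>m n n :: 'a mat)" "j < dim_col (0\<^sub>m n n :: 'a mat)"
      have "(A * C) $$ (i, j) = row A i \<bullet> v" using A C ij v by (simp add: C_def)
      also have "\<dots> = (A *\<^sub>v v) $ i" using A ij by simp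
      finally show "(A * C) $$ (i, j) = 0\<^sub>m n n $$ (i, j)" using v ij by simp
    qed (use A C in auto)
    hence C0: "C = 0\<^sub>m n n" by (rule inj[OF C])
    have "v = 0\<^sub>v n"
    proof (rule eq_vecI)
      fix i assume i: "i < dim_vec (0\<^sub>v n :: 'a vec)"
      have "v $ i = C $$ (i, i)" using i v by (simp add: C_def mat_of_cols_def)
      thus "v $ i = 0\<^sub>v n $ i" using C0 i by simp
    qed (use v in auto)
    thus False using v by simp
  qed
  thus ?thesis by (simp add: invertible_mat_iff_det[OF A])
qed

lemma invertible_mat_mult:
  fixes A B :: "'a :: field mat"
  assumes "A \<in> carrier_mat n n" "B \<in> carrier_mat n n" "invertible_mat A" "invertible_mat B"
  shows "invertible_mat (A * B)"
  using assms by (simp add: invertible_mat_iff_det[of _ n] det_mult)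

lemma invertible_mat_right_inverseI:
  fixes A :: "'a :: field mat"
  assumes "A \<in> carrier_mat n n" "B \<in> carrier_mat n n" "A * B = 1\<^sub>m n"
  shows "invertible_mat A"
  using assms mat_mult_left_right_inverse[OF assms]
  unfolding invertible_mat_def inverts_mat_def by auto

lemma append_rows_mult:
  assumes "A \<in> carrier_mat nr1 nc" "B \<in> carrier_mat nr2 nc" "C \<in> carrier_mat nc k"
  shows "(A @\<^sub>r B) * C = (A * C) @\<^sub>r (B * C)"
  using assms by (intro eq_matI) (auto simp: append_rows_def scalar_prod_def)

lemma four_block_mult_append_rows:
  assumes "P \<in> carrier_mat n n" "A \<in> carrier_mat n m" "B \<in> carrier_mat n m"
  shows "four_block_mat P (0\<^sub>m n n) (0\<^sub>m n n) P * (A @\<^sub>r B) = (P * A) @\<^sub>r (P * B)"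
  unfolding append_rows_def using assms
  by (subst mult_four_block_mat[of _ n n _ n _ n _ _ m _ 0]) auto

lemma smult_mat_mult:
  fixes A B :: "'a :: comm_semiring_0 mat"
  assumes "dim_col A = dim_row B"
  shows "c \<cdot>\<^sub>m A * B = c \<cdot>\<^sub>m (A * B)" "A * (c \<cdot>\<^sub>m B) = c \<cdot>\<^sub>m (A * B)"
  by (rule mult_smult_assoc_mat[of _ "dim_row A" "dim_col A" _ "dim_col B"]; use assms in auto)
    (rule mult_smult_distrib[of _ "dim_row A" "dim_col A" _ "dim_col B"]; use assms in auto)

lemma smult_mat_cancel:
  fixes A B :: "'a :: field mat"
  assumes "c \<noteq> 0" "c \<cdot>\<^sub>m A = c \<cdot>\<^sub>m B"
  shows "A = B"
proof -
  have "inverse c \<cdot>\<^sub>m (c \<cdot>\<^sub>m C) = C" for C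
    using assms(1) by (intro eq_matI) auto
  thus ?thesis using assms(2) by metis
qed

lemma split_block_obtain:
  assumes "A \<in> carrier_mat (n + m) (k + l)"
  obtains A1 A2 A3 A4 where "A1 \<in> carrier_mat n k" "A2 \<in> carrier_mat n l"
    "A3 \<in> carrier_mat m k" "A4 \<in> carrier_mat m l" "A = four_block_mat A1 A2 A3 A4"
proof -
  obtain A1 A2 A3 A4 where "split_block A n k = (A1, A2, A3, A4)"
    by (cases "split_block A n k") auto
  from split_block[OF this, of m l] assms that show ?thesis by auto
qed

lemma four_block_mat_inject:
  assumes "A \<in> carrier_mat nr1 nc1" "B \<in> carrier_mat nr1 nc2"
    "C \<in> carrier_mat nr2 nc1" "D \<in> carrier_mat nr2 nc2"
    "A' \<in> carrier_mat nr1 nc1" "B' \<in> carrier_mat nr1 nc2"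
    "C' \<in> carrier_mat nr2 nc1" "D' \<in> carrier_mat nr2 nc2"
    and eq: "four_block_mat A B C D = four_block_mat A' B' C' D'"
  shows "A = A'" "B = B'" "C = C'" "D = D'"
proof -
  have e: "four_block_mat A B C D $$ ij = four_block_mat A' B' C' D' $$ ij" for ij
    by (simp add: eq)
  show "A = A'"
  proof (rule eq_matI)
    fix i j assume "i < dim_row A'" "j < dim_col A'"
    thus "A $$ (i, j) = A' $$ (i, j)" using e[of "(i, j)"] assms(1-8) by simp
  qed (use assms(1-8) in auto)
  show "B = B'"
  proof (rule eq_matI)
    fix i j assume "i < dim_row B'" "j < dim_col B'"
    thus "B $$ (i, j) = B' $$ (i, j)" using e[of "(i, nc1 + j)"] assms(1-8) by simp
  qed (use assms(1-8) in auto)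
  show "C = C'"
  proof (rule eq_matI)
    fix i j assume "i < dim_row C'" "j < dim_col C'"
    thus "C $$ (i, j) = C' $$ (i, j)" using e[of "(nr1 + i, j)"] assms(1-8) by simp
  qed (use assms(1-8) in auto)
  show "D = D'"
  proof (rule eq_matI)
    fix i j assume "i < dim_row D'" "j < dim_col D'"
    thus "D $$ (i, j) = D' $$ (i, j)" using e[of "(nr1 + i, nc1 + j)"] assms(1-8) by simp
  qed (use assms(1-8) in auto)
qed

lemma mult_diag_four_block:
  assumes "A \<in> carrier_mat n n" "B \<in> carrier_mat n n"
    and "C \<in> carrier_mat m m" "D \<in> carrier_mat m m"
  shows "four_block_mat A (0\<^sub>m n m) (0\<^sub>m m n) C * four_block_mat B (0\<^sub>m n m) (0\<^sub>m m n) D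
       = four_block_mat (A * B) (0\<^sub>m n m) (0\<^sub>m m n) (C * D)"
  using assms by (subst mult_four_block_mat[of _ n n _ m _ m _ _ n _ m]) auto

lemma four_block_diag_intertwine:
  fixes A1 :: "'a :: field mat"
  assumes L: "L1 \<in> carrier_mat n n" "L2 \<in> carrier_mat m m"
    and D: "D1 \<in> carrier_mat n n" "D2 \<in> carrier_mat m m"
    and A: "A1 \<in> carrier_mat n n" "A2 \<in> carrier_mat n m"
      "A3 \<in> carrier_mat m n" "A4 \<in> carrier_mat m m"
    and eq: "four_block_mat L1 (0\<^sub>m n m) (0\<^sub>m m n) L2 * four_block_mat A1 A2 A3 A4
           = four_block_mat A1 A2 A3 A4 * four_block_mat D1 (0\<^sub>m n m) (0\<^sub>m m n) D2"
  shows "L1 * A1 = A1 * D1" "L1 * A2 = A2 * D2" "L2 * A3 = A3 * D1" "L2 * A4 = A4 * D2"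
proof -
  have "four_block_mat L1 (0\<^sub>m n m) (0\<^sub>m m n) L2 * four_block_mat A1 A2 A3 A4
      = four_block_mat (L1 * A1) (L1 * A2) (L2 * A3) (L2 * A4)"
    using L A by (subst mult_four_block_mat[of _ n n _ m _ m _ _ n _ m]) auto
  moreover have "four_block_mat A1 A2 A3 A4 * four_block_mat D1 (0\<^sub>m n m) (0\<^sub>m m n) D2
      = four_block_mat (A1 * D1) (A2 * D2) (A3 * D1) (A4 * D2)"
    using D A by (subst mult_four_block_mat[of _ n n _ m _ m _ _ n _ m]) auto
  ultimately have e: "four_block_mat (L1 * A1) (L1 * A2) (L2 * A3) (L2 * A4)
      = four_block_mat (A1 * D1) (A2 * D2) (A3 * D1) (A4 * D2)"
    using eq by simp
  show "L1 * A1 = A1 * D1" "L1 * A2 = A2 * D2" "L2 * A3 = A3 * D1" "L2 * A4 = A4 * D2"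
    using four_block_mat_inject[OF _ _ _ _ _ _ _ _ e, of n n m m] L D A by auto
qed

lemma intertwiner_inverse:
  fixes B P Q :: "complex mat"
  assumes B: "B \<in> carrier_mat n n" "invertible_mat B" and P: "P \<in> carrier_mat n n" "Q \<in> carrier_mat n n"
    and eq: "P * B = B * Q"
  shows "Q * mat_inv B = mat_inv B * P"
proof -
  note Bi = mat_inv[OF B]
  have "Q * mat_inv B = mat_inv B * (B * Q) * mat_inv B"
    unfolding assoc_mult_mat[OF Bi(1) B(1) P(2), symmetric] Bi(3) left_mult_one_mat[OF P(2)] ..
  also have "\<dots> = mat_inv B * P * (B * mat_inv B)"
    unfolding eq[symmetric] using P B(1) Bi(1) by (simp add: mult_mat_assoc)
  also have "\<dots> = mat_inv B * P"
    unfolding Bi(2) by (rule right_mult_one_mat[OF mult_carrier_mat[OF Bi(1) P(1)]])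
  finally show ?thesis .
qed

section \<open>Intertwiners of triangular matrices\<close>

text \<open>
  A triangular instance of the uniqueness part of Sylvester's theorem, by elimination of one entry
  after the other: entry \<open>(i, j)\<close> of \<open>L Y = Y D\<close> reads \<open>(L\<^sub>i\<^sub>i - D\<^sub>j\<^sub>j) Y\<^sub>i\<^sub>j = 0\<close> as soon as the entries before
  it vanish. The rank function \<open>r\<close> gives the order in which the rows are treated; it covers lower
  triangular \<open>L\<close> (\<open>r\<close> the identity) as well as upper triangular \<open>L\<close> (\<open>r\<close> decreasing).
\<close>

lemma intertwiner_eq_zero:
  fixes L D Y :: "'a :: field mat" and r :: "nat \<Rightarrow> nat"
  assumes L: "L \<in> carrier_mat n n" and D: "D \<in> carrier_mat m m" and Y: "Y \<in> carrier_mat n m"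
    and LY: "L * Y = Y * D"
    and triL: "\<And>i k. i < n \<Longrightarrow> k < n \<Longrightarrow> k \<noteq> i \<Longrightarrow> \<not> r k < r i \<Longrightarrow> L $$ (i, k) = 0"
    and triD: "upper_triangular D"
    and disj: "\<And>i j. i < n \<Longrightarrow> j < m \<Longrightarrow> L $$ (i, i) \<noteq> D $$ (j, j)"
  shows "Y = 0\<^sub>m n m"
proof -
  have "Y $$ (i, j) = 0" if "i < n" "j < m" for i j
    using that
  proof (induction "r i + j" arbitrary: i j rule: less_induct)
    case less
    note ij = \<open>i < n\<close> \<open>j < m\<close>
    have "(L * Y) $$ (i, j) = (\<Sum>k<n. L $$ (i, k) * Y $$ (k, j))"
      using L Y ij by (auto simp: scalar_prod_def lessThan_atLeast0)
    also have "\<dots> = (\<Sum>k<n. if k = i then L $$ (i, i) * Y $$ (i, j) else 0)"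
      using ij triL less.hyps by (intro sum.cong) (auto, metis add_less_cancel_right)
    also have "\<dots> = L $$ (i, i) * Y $$ (i, j)"
      using ij by simp
    finally have 1: "(L * Y) $$ (i, j) = L $$ (i, i) * Y $$ (i, j)" .
    have "(Y * D) $$ (i, j) = (\<Sum>k<m. Y $$ (i, k) * D $$ (k, j))"
      using D Y ij by (auto simp: scalar_prod_def lessThan_atLeast0)
    also have "\<dots> = (\<Sum>k<m. if k = j then Y $$ (i, j) * D $$ (j, j) else 0)"
    proof (intro sum.cong refl)
      fix k assume k: "k \<in> {..<m}"
      consider "k = j" | "k < j" | "j < k" by linarith
      thus "Y $$ (i, k) * D $$ (k, j) = (if k = j then Y $$ (i, j) * D $$ (j, j) else 0)"
        using less.hyps[of i k] ij k upper_triangularD[OF triD] D by cases auto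
    qed
    also have "\<dots> = Y $$ (i, j) * D $$ (j, j)"
      using ij by simp
    finally show ?case using 1 LY disj[OF ij] by simp
  qed
  thus ?thesis using Y by (intro eq_matI) auto
qed

section \<open>The operation \<open>\<star>\<close> on matrices\<close>

lemma sstar_sstar [simp]: "sstar st (sstar st a) = a"
  by (cases st) auto
lemma sstar_mult: "sstar st (a * b) = sstar st a * sstar st b"
  by (cases st) auto
lemma sstar_0 [simp]: "sstar st 0 = 0"
  by (cases st) auto
lemma sstar_sum: "sstar st (\<Sum>i\<in>I. f i) = (\<Sum>i\<in>I. sstar st (f i))"
  by (cases st) auto
lemma mstar_carrier [simp]: "A \<in> carrier_mat n m \<Longrightarrow> mstar st A \<in> carrier_mat m n"
  by auto

lemma mstar_mstar [simp]: "mstar st (mstar st A) = A"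
  by (intro eq_matI) (auto simp: mstar_index)

lemma mstar_mult:
  assumes "dim_col A = dim_row B"
  shows "mstar st (A * B) = mstar st B * mstar st A"
  using assms
  by (intro eq_matI) (auto simp: mstar_index scalar_prod_def sstar_sum sstar_mult mult.commute)

lemma mstar_zero: "mstar st (0\<^sub>m n m) = 0\<^sub>m m n"
  by (intro eq_matI) (auto simp: mstar_index)

lemma mstar_one: "mstar st (1\<^sub>m n) = 1\<^sub>m n"
  by (intro eq_matI) (auto simp: mstar_index, (cases st; simp)+)

lemma mstar_four_block:
  assumes "A \<in> carrier_mat nr1 nc1" "B \<in> carrier_mat nr1 nc2"
    "C \<in> carrier_mat nr2 nc1" "D \<in> carrier_mat nr2 nc2"
  shows "mstar st (four_block_mat A B C D)
    = four_block_mat (mstar st A) (mstar st C) (mstar st B) (mstar st D)"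
  using assms by (intro eq_matI) (auto simp: mstar_index)

lemma invertible_mat_mstar:
  assumes A: "A \<in> carrier_mat n n" "invertible_mat A"
  shows "invertible_mat (mstar st A)"
proof (rule invertible_mat_right_inverseI)
  note i = mat_inv[OF A]
  show "mstar st A * mstar st (mat_inv A) = 1\<^sub>m n"
    using A(1) i(1) by (simp add: i(3) mstar_one flip: mstar_mult)
qed (use A mat_inv[OF A] in auto)

section \<open>Reordering the blocks of a Jordan matrix\<close>

text \<open>
  The similarity is given by the block permutation matrix that exchanges the two summands.
\<close>

lemma similar_four_block_swap:
  fixes A B :: "'a :: field mat"
  assumes A: "A \<in> carrier_mat n n" and B: "B \<in> carrier_mat m m"
  shows "similar_mat (four_block_mat A (0\<^sub>m n m) (0\<^sub>m m n) B)
                     (four_block_mat B (0\<^sub>m m n) (0\<^sub>m n m) A)"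
proof -
  let ?P = "four_block_mat (0\<^sub>m n m) (1\<^sub>m n) (1\<^sub>m m) (0\<^sub>m m n) :: 'a mat"
  let ?Q = "four_block_mat (0\<^sub>m m n) (1\<^sub>m m) (1\<^sub>m n) (0\<^sub>m n m) :: 'a mat"
  let ?AB = "four_block_mat A (0\<^sub>m n m) (0\<^sub>m m n) B"
  let ?BA = "four_block_mat B (0\<^sub>m m n) (0\<^sub>m n m) A"
  have PQ: "?P * ?Q = 1\<^sub>m (n + m)"
    by (subst mult_four_block_mat[of _ n m _ n _ m _ _ n _ m]) auto
  have QP: "?Q * ?P = 1\<^sub>m (n + m)"
    by (subst mult_four_block_mat[of _ m n _ m _ n _ _ m _ n]) (auto simp: add.commute[of n m])
  have "?P * ?BA = four_block_mat (0\<^sub>m n m) A B (0\<^sub>m m n)"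
    using A B by (subst mult_four_block_mat[of _ n m _ n _ m _ _ m _ n]) auto
  hence "?P * ?BA * ?Q = ?AB"
    using A B by (simp, subst mult_four_block_mat[of _ n m _ n _ m _ _ n _ m]) auto
  hence "?AB = ?P * ?BA * ?Q" ..
  moreover have "{?AB, ?BA, ?P, ?Q} \<subseteq> carrier_mat (n + m) (n + m)"
    using A B by (auto intro!: carrier_matI)
  ultimately show ?thesis by (intro similar_matI[OF _ PQ QP])
qed

lemma jordan_matrix_append:
  "jordan_matrix (xs @ ys) = four_block_mat
     (jordan_matrix xs) (0\<^sub>m (sum_list (map fst xs)) (sum_list (map fst ys)))
     (0\<^sub>m (sum_list (map fst ys)) (sum_list (map fst xs))) (jordan_matrix ys)"
  unfolding jordan_matrix_def map_append diag_block_mat_append Let_def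
  unfolding jordan_matrix_def[symmetric] by simp

lemma similar_jordan_matrix_append_cong:
  fixes xs ys :: "(nat \<times> 'a :: field) list"
  assumes "similar_mat (jordan_matrix xs) (jordan_matrix xs')"
    "similar_mat (jordan_matrix ys) (jordan_matrix ys')"
  shows "similar_mat (jordan_matrix (xs @ ys)) (jordan_matrix (xs' @ ys'))"
proof -
  have dim: "sum_list (map fst us) = sum_list (map fst vs)"
    if sim: "similar_mat (jordan_matrix us) (jordan_matrix vs)" for us vs :: "(nat \<times> 'a) list"
  proof -
    obtain n where "jordan_matrix us \<in> carrier_mat n n" "jordan_matrix vs \<in> carrier_mat n n"
      using similar_matD[OF sim] by blast
    thus ?thesis by (metis carrier_matD(1) jordan_matrix_dim(1))
  qed
  show ?thesis
    unfolding jordan_matrix_append dim[OF assms(1), symmetric] dim[OF assms(2), symmetric]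
    by (rule similar_mat_four_block_0_0[OF assms jordan_matrix_carrier jordan_matrix_carrier])
qed

text \<open>
  The first block of one list is moved to its place in the other by a swap of adjacent groups of blocks.
\<close>

lemma similar_jordan_matrix_perm:
  fixes xs ys :: "(nat \<times> 'a :: field) list"
  assumes "mset xs = mset ys"
  shows "similar_mat (jordan_matrix xs) (jordan_matrix ys)"
  using assms
proof (induction xs arbitrary: ys)
  case Nil
  thus ?case using similar_mat_refl[OF jordan_matrix_carrier] by simp
next
  case (Cons x xs)
  from Cons.prems have "x \<in> set ys" by (metis list.set_intros(1) set_mset_mset)
  then obtain us vs where ys: "ys = us @ x # vs" by (auto simp: in_set_conv_decomp)
  have IH: "similar_mat (jordan_matrix xs) (jordan_matrix (us @ vs))"
    by (rule Cons.IH) (use Cons.prems ys in simp)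
  have refl: "similar_mat (jordan_matrix zs) (jordan_matrix zs)" for zs :: "(nat \<times> 'a) list"
    by (rule similar_mat_refl[OF jordan_matrix_carrier])
  have "similar_mat (jordan_matrix ([x] @ xs)) (jordan_matrix ([x] @ (us @ vs)))"
    by (rule similar_jordan_matrix_append_cong[OF refl IH])
  note step = this
  have "similar_mat (jordan_matrix ([x] @ us)) (jordan_matrix (us @ [x]))"
    unfolding jordan_matrix_append by (rule similar_four_block_swap) auto
  from similar_jordan_matrix_append_cong[OF this refl[of vs]]
  have "similar_mat (jordan_matrix ([x] @ (us @ vs))) (jordan_matrix ys)"
    by (simp add: ys)
  from similar_mat_trans[OF step this] show ?case by simp
qed

lemma mset_concat_filter_partition:
  assumes "distinct gs" "f ` set xs \<subseteq> set gs"
  shows "mset (concat (map (\<lambda>g. filter (\<lambda>x. f x = g) xs) gs)) = mset xs"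
  using assms
proof (induction gs arbitrary: xs)
  case Nil
  thus ?case by auto
next
  case (Cons g gs)
  let ?ys = "filter (\<lambda>x. f x \<noteq> g) xs"
  have same: "filter (\<lambda>x. f x = h) ?ys = filter (\<lambda>x. f x = h) xs" if "h \<noteq> g" for h
    using that by (induction xs) auto
  have rest: "map (\<lambda>h. filter (\<lambda>x. f x = h) xs) gs = map (\<lambda>h. filter (\<lambda>x. f x = h) ?ys) gs"
  proof (rule map_cong[OF refl])
    fix h assume "h \<in> set gs"
    hence "h \<noteq> g" using Cons.prems(1) by auto
    thus "filter (\<lambda>x. f x = h) xs = filter (\<lambda>x. f x = h) ?ys" by (rule same[symmetric])
  qed
  have parts: "mset (filter (\<lambda>x. f x = g) xs) + mset ?ys = mset xs"
    by (induction xs) auto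
  have "mset (concat (map (\<lambda>h. filter (\<lambda>x. f x = h) ?ys) gs)) = mset ?ys"
    using Cons.prems by (intro Cons.IH) auto
  thus ?case
    unfolding list.map concat.simps mset_append rest using parts by (simp only:)
qed

section \<open>The commutant of a nonderogatory Jordan matrix\<close>

text \<open>
  The matrices that commute with a Jordan block are the upper triangular Toeplitz matrices: comparing
  the entries of \<open>N A\<close> and \<open>A N\<close> shows that each row of \<open>A\<close> is the previous one shifted by one place.
\<close>

lemma commutes_jordan_block_index:
  fixes A :: "'a :: field mat"
  assumes A: "A \<in> carrier_mat n n" and comm: "jordan_block n a * A = A * jordan_block n a"
    and "i < n" "j < n"
  shows "A $$ (i, j) = (if i \<le> j then A $$ (0, j - i) else 0)"
  using assms(3,4)
proof (induction i arbitrary: j)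
  case 0
  thus ?case by simp
next
  case (Suc i)
  have "(jordan_block n a * A) $$ (i, j)
      = (\<Sum>k<n. jordan_block n a $$ (i, k) * A $$ (k, j))"
    using A Suc.prems by (auto simp: scalar_prod_def lessThan_atLeast0)
  also have "\<dots> = (\<Sum>k<n. (if k = i then a * A $$ (k, j) else 0)
      + (if k = Suc i then A $$ (k, j) else 0))"
    using Suc.prems by (intro sum.cong) auto
  also have "\<dots> = a * A $$ (i, j) + A $$ (Suc i, j)"
    using Suc.prems by (simp add: sum.distrib)
  finally have 1: "(jordan_block n a * A) $$ (i, j) = a * A $$ (i, j) + A $$ (Suc i, j)" .
  have "(A * jordan_block n a) $$ (i, j)
      = (\<Sum>k<n. A $$ (i, k) * jordan_block n a $$ (k, j))"
    using A Suc.prems by (auto simp: scalar_prod_def lessThan_atLeast0)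
  also have "\<dots> = (\<Sum>k<n. (if k = j then a * A $$ (i, k) else 0)
      + (if Suc k = j then A $$ (i, k) else 0))"
    using Suc.prems by (intro sum.cong) auto
  also have "\<dots> = a * A $$ (i, j) + (\<Sum>k<n. if Suc k = j then A $$ (i, k) else 0)"
    using Suc.prems by (simp add: sum.distrib)
  also have "(\<Sum>k<n. if Suc k = j then A $$ (i, k) else 0)
      = (if j = 0 then 0 else A $$ (i, j - 1))"
    using Suc.prems by (cases j) auto
  finally have "A $$ (Suc i, j) = (if j = 0 then 0 else A $$ (i, j - 1))"
    using 1 comm by simp
  thus ?case using Suc.IH[of "j - 1"] Suc.prems by (cases j) auto
qed

text \<open>
  By the Toeplitz form, an entry of the product is a convolution of the first rows, which is symmetric
  in the two factors.
\<close>

lemma commutant_jordan_block_commutative: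
  fixes A B :: "'a :: field mat"
  assumes A: "A \<in> carrier_mat n n" "jordan_block n a * A = A * jordan_block n a"
    and B: "B \<in> carrier_mat n n" "jordan_block n a * B = B * jordan_block n a"
  shows "A * B = B * A"
proof (rule eq_matI)
  note iA = commutes_jordan_block_index[OF A] and iB = commutes_jordan_block_index[OF B]
  \<comment> \<open>The Toeplitz form of both factors restricts the sum to \<open>i \<le> k \<le> j\<close>.\<close>
  have prod: "(C * D) $$ (i, j) = (\<Sum>k\<in>{i..j}. C $$ (0, k - i) * D $$ (0, j - k))"
    if C: "C \<in> carrier_mat n n" "\<And>i j. i < n \<Longrightarrow> j < n \<Longrightarrow> C $$ (i, j) = (if i \<le> j then C $$ (0, j - i) else 0)"
      and D: "D \<in> carrier_mat n n" "\<And>i j. i < n \<Longrightarrow> j < n \<Longrightarrow> D $$ (i, j) = (if i \<le> j then D $$ (0, j - i) else 0)"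
      and ij: "i < n" "j < n" for C D :: "'a mat" and i j
  proof -
    have "(C * D) $$ (i, j) = (\<Sum>k<n. C $$ (i, k) * D $$ (k, j))"
      using C(1) D(1) ij by (auto simp: scalar_prod_def lessThan_atLeast0)
    also have "\<dots> = (\<Sum>k\<in>{i..j}. C $$ (0, k - i) * D $$ (0, j - k))"
      using ij C(2)[of i] D(2)[of _ j] by (intro sum.mono_neutral_cong_right) auto
    finally show ?thesis .
  qed
  fix i j assume "i < dim_row (B * A)" "j < dim_col (B * A)"
  hence ij: "i < n" "j < n" using A B by auto
  have "(A * B) $$ (i, j) = (\<Sum>k\<in>{i..j}. A $$ (0, k - i) * B $$ (0, j - k))"
    by (rule prod[OF A(1) iA B(1) iB ij])
  also have "\<dots> = (\<Sum>k\<in>{i..j}. B $$ (0, k - i) * A $$ (0, j - k))"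
    by (rule sum.reindex_bij_witness[of _ "\<lambda>k. i + j - k" "\<lambda>k. i + j - k"]) (auto simp: mult.commute)
  also have "\<dots> = (B * A) $$ (i, j)"
    by (rule prod[OF B(1) iB A(1) iA ij, symmetric])
  finally show "(A * B) $$ (i, j) = (B * A) $$ (i, j)" .
qed (use A B in auto)

lemma jordan_matrix_diag_mem:
  "i < sum_list (map fst xs) \<Longrightarrow> jordan_matrix xs $$ (i, i) \<in> snd ` set xs"
proof (induction xs arbitrary: i)
  case (Cons x xs)
  obtain k a where x: "x = (k, a)" by force
  show ?case
    using Cons.IH[of "i - k"] Cons.prems by (auto simp: x jordan_matrix_Cons)
qed auto

lemma jordan_matrix_upper_triangular': "upper_triangular (jordan_matrix xs)"
  by (intro upper_triangularI) (auto simp: jordan_matrix_upper_triangular)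

lemma jordan_matrix_diag_set: "set (diag_mat (jordan_matrix xs)) \<subseteq> snd ` set xs"
  using jordan_matrix_diag_mem[of _ xs] by (auto simp: diag_mat_def)

text \<open>
  Blocks of different eigenvalues have no nonzero intertwiners, so that the commutant is the direct sum
  of the commutants of the single Jordan blocks.
\<close>

lemma commutant_jordan_matrix_commutative:
  fixes A B :: "'a :: field mat"
  assumes "distinct (map snd xs)"
    and "A \<in> carrier_mat (sum_list (map fst xs)) (sum_list (map fst xs))"
    and "jordan_matrix xs * A = A * jordan_matrix xs"
    and "B \<in> carrier_mat (sum_list (map fst xs)) (sum_list (map fst xs))"
    and "jordan_matrix xs * B = B * jordan_matrix xs"
  shows "A * B = B * A"
  using assms
proof (induction xs arbitrary: A B)
  case Nil
  from Nil.prems(2,4) show ?case by (intro eq_matI) auto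
next
  case (Cons x xs)
  obtain k a where x: "x = (k, a)" by force
  let ?m = "sum_list (map fst xs)" and ?N = "jordan_block k a" and ?J = "jordan_matrix xs"
  have ne: "a \<noteq> ?J $$ (i, i)" if "i < ?m" for i
    using jordan_matrix_diag_mem[OF that] Cons.prems(1) by (auto simp: x)
  have split: "\<exists>C1 C4. C1 \<in> carrier_mat k k \<and> C4 \<in> carrier_mat ?m ?m \<and>
      C = four_block_mat C1 (0\<^sub>m k ?m) (0\<^sub>m ?m k) C4 \<and> ?N * C1 = C1 * ?N \<and> ?J * C4 = C4 * ?J"
    if C: "C \<in> carrier_mat (k + ?m) (k + ?m)"
      and comm: "jordan_matrix (x # xs) * C = C * jordan_matrix (x # xs)" for C :: "'a mat"
  proof -
    obtain C1 C2 C3 C4 where C': "C1 \<in> carrier_mat k k" "C2 \<in> carrier_mat k ?m"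
      "C3 \<in> carrier_mat ?m k" "C4 \<in> carrier_mat ?m ?m" and Ceq: "C = four_block_mat C1 C2 C3 C4"
      using split_block_obtain[OF C] .
    note eqs = four_block_diag_intertwine[OF jordan_block_carrier jordan_matrix_carrier
        jordan_block_carrier jordan_matrix_carrier C' comm[unfolded x jordan_matrix_Cons Ceq]]
    have "C2 = 0\<^sub>m k ?m"
    proof (rule intertwiner_eq_zero[OF _ _ C'(2) eqs(2), of "\<lambda>i. k - i"])
      fix i j assume "i < k" "j < k" "j \<noteq> i" "\<not> k - j < k - i"
      thus "?N $$ (i, j) = 0" by auto
    next
      fix i j assume "i < k" "j < ?m"
      thus "?N $$ (i, i) \<noteq> ?J $$ (j, j)" using ne[of j] by simp
    qed (rule jordan_block_carrier jordan_matrix_carrier jordan_matrix_upper_triangular')+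
    moreover have "C3 = 0\<^sub>m ?m k"
    proof (rule intertwiner_eq_zero[OF _ _ C'(3) eqs(3), of "\<lambda>i. ?m - i"])
      fix i j assume "i < ?m" "j < ?m" "j \<noteq> i" "\<not> ?m - j < ?m - i"
      thus "?J $$ (i, j) = 0" by (intro jordan_matrix_upper_triangular) auto
    next
      fix i j assume "i < ?m" "j < k"
      thus "?J $$ (i, i) \<noteq> ?N $$ (j, j)" using ne[of i] by simp
    next
      show "upper_triangular ?N" by (intro upper_triangularI) auto
    qed (rule jordan_block_carrier jordan_matrix_carrier)+
    ultimately show ?thesis using C' Ceq eqs by blast
  qed
  have dims: "sum_list (map fst (x # xs)) = k + ?m" by (simp add: x)
  obtain A1 A4 where A: "A1 \<in> carrier_mat k k" "A4 \<in> carrier_mat ?m ?m"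
      "A = four_block_mat A1 (0\<^sub>m k ?m) (0\<^sub>m ?m k) A4" "?N * A1 = A1 * ?N" "?J * A4 = A4 * ?J"
    using split[OF Cons.prems(2)[unfolded dims] Cons.prems(3)] by blast
  obtain B1 B4 where B: "B1 \<in> carrier_mat k k" "B4 \<in> carrier_mat ?m ?m"
      "B = four_block_mat B1 (0\<^sub>m k ?m) (0\<^sub>m ?m k) B4" "?N * B1 = B1 * ?N" "?J * B4 = B4 * ?J"
    using split[OF Cons.prems(4)[unfolded dims] Cons.prems(5)] by blast
  have "A1 * B1 = B1 * A1"
    by (rule commutant_jordan_block_commutative[OF A(1,4) B(1,4)])
  moreover have "A4 * B4 = B4 * A4"
    by (rule Cons.IH[OF _ A(2,5) B(2,5)]) (use Cons.prems(1) in simp)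
  ultimately show ?case
    unfolding A(3) B(3) mult_diag_four_block[OF A(1) B(1) A(2) B(2)]
      mult_diag_four_block[OF B(1) A(1) B(2) A(2)] by (simp only:)
qed

section \<open>Splitting a palindromic system along a block-diagonal intertwiner\<close>

lemma diag_mat_diag_block_mat:
  assumes "\<forall>D \<in> set Ds. square_mat D"
  shows "diag_mat (diag_block_mat Ds) = concat (map diag_mat Ds)"
  using assms
proof (induction Ds)
  case Nil
  show ?case by (simp add: diag_mat_def)
next
  case (Cons D Ds)
  define n where "n = dim_row D"
  define m where "m = dim_row (diag_block_mat Ds)"
  have D: "D \<in> carrier_mat n n" using Cons.prems by (auto simp: n_def)
  have "square_mat (diag_block_mat Ds)"
    using Cons.prems by (intro diag_block_mat_square) auto
  hence E: "diag_block_mat Ds \<in> carrier_mat m m" by (auto simp: m_def)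
  have "diag_mat (diag_block_mat (D # Ds)) = diag_mat D @ diag_mat (diag_block_mat Ds)"
    using D E by (simp add: Let_def diag_four_block_mat[of _ n _ m])
  thus ?case using Cons by simp
qed

lemma upper_triangular_diag_block_mat:
  assumes "\<forall>D \<in> set Ds. square_mat D \<and> upper_triangular D"
  shows "upper_triangular (diag_block_mat Ds)"
proof (rule upper_triangularI)
  fix i j assume "j < i" "i < dim_row (diag_block_mat Ds)"
  thus "diag_block_mat Ds $$ (i, j) = 0"
    using assms by (intro diag_block_upper_triangular) (auto intro: upper_triangularD)
qed

text \<open>
  Block-diagonal coefficients give a block-diagonal system, which is what makes an induction over the
  list of blocks possible.
\<close>

lemma pal_poly_four_block:
  assumes "A1 \<in> carrier_mat n n" "A0 \<in> carrier_mat n n"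
    and "B1 \<in> carrier_mat m m" "B0 \<in> carrier_mat m m"
  shows "pal_poly st \<epsilon> (four_block_mat A1 (0\<^sub>m n m) (0\<^sub>m m n) B1)
           (four_block_mat A0 (0\<^sub>m n m) (0\<^sub>m m n) B0) z
       = four_block_mat (pal_poly st \<epsilon> A1 A0 z) (0\<^sub>m n m) (0\<^sub>m m n) (pal_poly st \<epsilon> B1 B0 z)"
  using assms by (intro eq_matI) (auto simp: pal_poly_def mstar_index)

text \<open>
  Here \<open>D\<^sup>\<star>\<close> is lower triangular, so its rows are treated from top to bottom.
\<close>

lemma mstar_intertwiner_eq_zero:
  assumes D: "D \<in> carrier_mat n n" "upper_triangular D" and E: "E \<in> carrier_mat m m" "upper_triangular E"
    and Y: "Y \<in> carrier_mat n m" and eq: "mstar st D * Y = Y * E"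
    and disj: "\<forall>a \<in> set (diag_mat D). \<forall>b \<in> set (diag_mat E). sstar st a \<noteq> b"
  shows "Y = 0\<^sub>m n m"
proof (rule intertwiner_eq_zero[OF _ E(1) Y eq, of "\<lambda>i. i"])
  fix i k assume "i < n" "k < n" "k \<noteq> i" "\<not> k < i"
  thus "mstar st D $$ (i, k) = 0"
    using D upper_triangularD[OF D(2), of i k] by (simp add: mstar_index)
next
  fix i j assume ij: "i < n" "j < m"
  have "D $$ (i, i) \<in> set (diag_mat D)" "E $$ (j, j) \<in> set (diag_mat E)"
    using ij D E by (auto simp: diag_mat_def)
  thus "mstar st D $$ (i, i) \<noteq> E $$ (j, j)"
    using disj D ij by (simp add: mstar_index)
qed (use D E in auto)

lemma pal_poly_congruence:
  assumes A1: "A1 \<in> carrier_mat n n" and A0: "A0 \<in> carrier_mat n n" and K: "K \<in> carrier_mat n n"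
  shows "mstar st K * pal_poly st \<epsilon> A1 A0 z * K
       = pal_poly st \<epsilon> (mstar st K * A1 * K) (mstar st K * A0 * K) z"
proof -
  have star: "mstar st (mstar st K * A1 * K) = mstar st K * mstar st A1 * K"
    using A1 K by (simp add: mstar_mult mult_mat_assoc)
  have smult: "mstar st K * (c \<cdot>\<^sub>m A) * K = c \<cdot>\<^sub>m (mstar st K * A * K)"
    if "A \<in> carrier_mat n n" for c A
    using that K by (simp add: smult_mat_mult)
  have add: "mstar st K * (A + B) * K = mstar st K * A * K + mstar st K * B * K"
    if "A \<in> carrier_mat n n" "B \<in> carrier_mat n n" for A B
    using that K by (simp add: mult_add_distrib_mat[of _ n n _ n] add_mult_distrib_mat[of _ n n _ _ n]
        mult_carrier_mat[of _ n n _ n])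
  show ?thesis
    unfolding pal_poly_def star using A1 A0 by (simp add: add smult)
qed

lemma pal_coeffs_congruence:
  assumes "pal_coeffs st \<epsilon> n A1 A0" "K \<in> carrier_mat n n"
  shows "pal_coeffs st \<epsilon> n (mstar st K * A1 * K) (mstar st K * A0 * K)"
proof -
  have c: "A1 \<in> carrier_mat n n" "A0 \<in> carrier_mat n n" and sym: "mstar st A0 = \<epsilon> \<cdot>\<^sub>m A0"
    using assms(1) by (auto simp: pal_coeffs_def)
  have "mstar st (mstar st K * A0 * K) = mstar st K * mstar st A0 * K"
    using c assms(2) by (simp add: mstar_mult mult_mat_assoc)
  also have "\<dots> = \<epsilon> \<cdot>\<^sub>m (mstar st K * A0 * K)"
    unfolding sym using c assms(2)
    by (simp add: smult_mat_mult)
  finally show ?thesis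
    using c assms(2) by (simp add: pal_coeffs_def mult_carrier_mat[of _ n n _ n])
qed

text \<open>
  By \<open>mstar_intertwiner_eq_zero\<close> both coefficients are block diagonal in the format of \<open>Ds\<close>. Symmetry and
  regularity pass to the blocks by comparison of blocks and by multiplicativity of the determinant. It is enough to
  compare each block with the later ones in one order, since \<open>\<star>\<close> is an involution on scalars.
\<close>

lemma block_diagonal_pal_system:
  assumes "\<forall>D \<in> set Ds. square_mat D \<and> upper_triangular D"
    and "sorted_wrt (\<lambda>D E. \<forall>a \<in> set (diag_mat D). \<forall>b \<in> set (diag_mat E). sstar st a \<noteq> b) Ds"
    and "pal_coeffs st \<epsilon> (dim_row (diag_block_mat Ds)) A1 A0" "invertible_mat A1"
    and "mstar st (diag_block_mat Ds) * A1 = A1 * diag_block_mat Ds"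
    and "mstar st (diag_block_mat Ds) * A0 = A0 * diag_block_mat Ds"
  shows "\<exists>Qs. length Qs = length Ds \<and>
    (\<forall>i < length Ds. regular_pal_system st \<epsilon> (dim_row (Ds ! i)) (Qs ! i)) \<and>
    (\<forall>z. pal_poly st \<epsilon> A1 A0 z = diag_block_mat (map (\<lambda>Q. Q z) Qs))"
  using assms
proof (induction Ds arbitrary: A1 A0)
  case Nil
  from Nil.prems(3) have "A1 \<in> carrier_mat 0 0" by (simp add: pal_coeffs_def)
  hence "pal_poly st \<epsilon> A1 A0 z = 0\<^sub>m 0 0" for z
    by (intro eq_matI) (auto simp: pal_poly_def)
  thus ?case by simp
next
  case (Cons D Ds)
  define E where "E = diag_block_mat Ds"
  define n where "n = dim_row D"
  define m where "m = dim_row E"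
  have D: "D \<in> carrier_mat n n" "upper_triangular D" using Cons.prems(1) by (auto simp: n_def)
  have "square_mat E"
    unfolding E_def using Cons.prems(1) by (intro diag_block_mat_square) auto
  hence E: "E \<in> carrier_mat m m" by (auto simp: m_def)
  have Eut: "upper_triangular E"
    unfolding E_def using Cons.prems(1) by (intro upper_triangular_diag_block_mat) auto
  have F: "diag_block_mat (D # Ds) = four_block_mat D (0\<^sub>m n m) (0\<^sub>m m n) E"
    using D E by (simp add: E_def Let_def)
  have Fstar: "mstar st (diag_block_mat (D # Ds))
      = four_block_mat (mstar st D) (0\<^sub>m n m) (0\<^sub>m m n) (mstar st E)"
    unfolding F using D E by (simp add: mstar_four_block[of _ n n _ m _ m] mstar_zero)
  have dim: "dim_row (diag_block_mat (D # Ds)) = n + m"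
    unfolding F using D E by simp
  have disj: "\<forall>a \<in> set (diag_mat D). \<forall>b \<in> set (diag_mat E). sstar st a \<noteq> b"
    using Cons.prems(1,2) unfolding E_def by (subst diag_mat_diag_block_mat) auto
  have disj': "\<forall>a \<in> set (diag_mat E). \<forall>b \<in> set (diag_mat D). sstar st a \<noteq> b"
    using disj by (metis sstar_sstar)
  note [simp del] = diag_block_mat.simps
  have split: "\<exists>A B. A \<in> carrier_mat n n \<and> B \<in> carrier_mat m m \<and>
      C = four_block_mat A (0\<^sub>m n m) (0\<^sub>m m n) B \<and>
      mstar st D * A = A * D \<and> mstar st E * B = B * E"
    if C: "C \<in> carrier_mat (n + m) (n + m)"
      and comm: "mstar st (diag_block_mat (D # Ds)) * C = C * diag_block_mat (D # Ds)" for C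
  proof -
    obtain C1 C2 C3 C4 where C': "C1 \<in> carrier_mat n n" "C2 \<in> carrier_mat n m"
      "C3 \<in> carrier_mat m n" "C4 \<in> carrier_mat m m" and Ceq: "C = four_block_mat C1 C2 C3 C4"
      using split_block_obtain[OF C] .
    note eqs = four_block_diag_intertwine[OF mstar_carrier[OF D(1)] mstar_carrier[OF E] D(1) E C'
        comm[unfolded Fstar, unfolded F Ceq]]
    have "C2 = 0\<^sub>m n m"
      by (rule mstar_intertwiner_eq_zero[OF D E Eut C'(2) eqs(2) disj])
    moreover have "C3 = 0\<^sub>m m n"
      by (rule mstar_intertwiner_eq_zero[OF E Eut D C'(3) eqs(3) disj'])
    ultimately show ?thesis using C' Ceq eqs by blast
  qed
  have A1: "A1 \<in> carrier_mat (n + m) (n + m)" and A0: "A0 \<in> carrier_mat (n + m) (n + m)"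
    and A0star: "mstar st A0 = \<epsilon> \<cdot>\<^sub>m A0"
    using Cons.prems(3) unfolding dim pal_coeffs_def by blast+
  obtain B1 C1 where BC1: "B1 \<in> carrier_mat n n" "C1 \<in> carrier_mat m m"
      "A1 = four_block_mat B1 (0\<^sub>m n m) (0\<^sub>m m n) C1"
      "mstar st D * B1 = B1 * D" "mstar st E * C1 = C1 * E"
    using split[OF A1 Cons.prems(5)] by blast
  obtain B0 C0 where BC0: "B0 \<in> carrier_mat n n" "C0 \<in> carrier_mat m m"
      "A0 = four_block_mat B0 (0\<^sub>m n m) (0\<^sub>m m n) C0"
      "mstar st D * B0 = B0 * D" "mstar st E * C0 = C0 * E"
    using split[OF A0 Cons.prems(6)] by blast
  have "four_block_mat (mstar st B0) (0\<^sub>m n m) (0\<^sub>m m n) (mstar st C0)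
      = four_block_mat (\<epsilon> \<cdot>\<^sub>m B0) (0\<^sub>m n m) (0\<^sub>m m n) (\<epsilon> \<cdot>\<^sub>m C0)"
    using A0star BC0(1,2) unfolding BC0(3)
    by (simp add: mstar_four_block[of _ n n _ m _ m] mstar_zero
        smult_four_block_mat[of _ n n _ m _ m])
  from four_block_mat_inject[OF _ _ _ _ _ _ _ _ this, of n n m m]
  have sym: "mstar st B0 = \<epsilon> \<cdot>\<^sub>m B0" "mstar st C0 = \<epsilon> \<cdot>\<^sub>m C0"
    using BC0(1,2) by simp_all
  have "det A1 = det B1 * det C1"
    unfolding BC1(3) by (rule det_four_block_mat_lower_left_zero[OF BC1(1) _ refl BC1(2)]) simp
  hence inv: "invertible_mat B1" "invertible_mat C1"
    using Cons.prems(4) invertible_mat_iff_det[OF A1] invertible_mat_iff_det[OF BC1(1)]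
      invertible_mat_iff_det[OF BC1(2)] by simp_all
  have "\<exists>Qs. length Qs = length Ds \<and>
    (\<forall>i < length Ds. regular_pal_system st \<epsilon> (dim_row (Ds ! i)) (Qs ! i)) \<and>
    (\<forall>z. pal_poly st \<epsilon> C1 C0 z = diag_block_mat (map (\<lambda>Q. Q z) Qs))"
  proof (rule Cons.IH)
    show "pal_coeffs st \<epsilon> (dim_row (diag_block_mat Ds)) C1 C0"
      using BC1(2) BC0(2) sym(2) by (simp add: pal_coeffs_def flip: E_def m_def)
  qed (use Cons.prems(1,2) inv(2) BC1(5) BC0(5) in \<open>simp_all flip: E_def\<close>)
  then obtain Qs where Qs: "length Qs = length Ds"
    "\<forall>i < length Ds. regular_pal_system st \<epsilon> (dim_row (Ds ! i)) (Qs ! i)"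
    "\<forall>z. pal_poly st \<epsilon> C1 C0 z = diag_block_mat (map (\<lambda>Q. Q z) Qs)" by blast
  let ?Q = "pal_poly st \<epsilon> B1 B0"
  have Q: "regular_pal_system st \<epsilon> (dim_row D) ?Q"
    unfolding regular_pal_system_def pal_coeffs_def using BC1(1) BC0(1) sym(1) inv(1) n_def by blast
  have "pal_poly st \<epsilon> A1 A0 z = diag_block_mat (map (\<lambda>Q. Q z) (?Q # Qs))" for z
  proof -
    have "?Q z \<in> carrier_mat n n" "pal_poly st \<epsilon> C1 C0 z \<in> carrier_mat m m"
      using BC1(1,2) BC0(1,2) by (auto simp: pal_poly_def)
    thus ?thesis
      unfolding BC1(3) BC0(3) pal_poly_four_block[OF BC1(1) BC0(1) BC1(2) BC0(2)] list.map
        diag_block_mat.simps Let_def Qs(3)[rule_format, symmetric] by simp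
  qed
  moreover have "regular_pal_system st \<epsilon> (dim_row ((D # Ds) ! i)) ((?Q # Qs) ! i)"
    if "i < length (D # Ds)" for i
    using that Q Qs(2) by (cases i) auto
  ultimately show ?case using Qs(1) by (intro exI[of _ "?Q # Qs"]) simp
qed

section \<open>The Jordan form grouped by star pairs\<close>

lemma mstar_jordan_matrix:
  "mstar st (jordan_matrix xs) = transpose_mat (jordan_matrix (map (\<lambda>(k, a). (k, sstar st a)) xs))"
proof (induction xs)
  case Nil
  show ?case by (intro eq_matI) auto
next
  case (Cons x xs)
  obtain k a where x: "x = (k, a)" by force
  have "mstar st (jordan_block k a) = transpose_mat (jordan_block k (sstar st a))"
    by (intro eq_matI) (auto simp: mstar_index, (cases st; simp)+)
  moreover have dim: "sum_list (map fst (map (\<lambda>(k, a). (k, sstar st a)) xs)) = sum_list (map fst xs)"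
    by (induction xs) auto
  note carrier = jordan_matrix_carrier[of "map (\<lambda>(k, a). (k, sstar st a)) xs", unfolded dim]
  have "mstar st (jordan_matrix (x # xs))
      = four_block_mat (mstar st (jordan_block k a)) (0\<^sub>m k (sum_list (map fst xs)))
          (0\<^sub>m (sum_list (map fst xs)) k) (mstar st (jordan_matrix xs))"
    unfolding x jordan_matrix_Cons
    by (simp add: mstar_zero
        mstar_four_block[of _ k k _ "sum_list (map fst xs)" _ "sum_list (map fst xs)"])
  moreover have "transpose_mat (jordan_matrix (map (\<lambda>(k, a). (k, sstar st a)) (x # xs)))
      = four_block_mat (transpose_mat (jordan_block k (sstar st a))) (0\<^sub>m k (sum_list (map fst xs)))
          (0\<^sub>m (sum_list (map fst xs)) k)
          (transpose_mat (jordan_matrix (map (\<lambda>(k, a). (k, sstar st a)) xs)))"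
    unfolding x list.map prod.case jordan_matrix_Cons dim
      transpose_four_block_mat[OF jordan_block_carrier zero_carrier_mat zero_carrier_mat carrier]
    by simp
  ultimately show ?case unfolding Cons.IH by (simp only:)
qed

lemma mstar_similar:
  assumes "similar_mat A B"
  shows "similar_mat (mstar st A) (mstar st B)"
proof -
  obtain n P Q where "{A, B, P, Q} \<subseteq> carrier_mat n n"
    and PQ: "P * Q = 1\<^sub>m n" and QP: "Q * P = 1\<^sub>m n" and A: "A = P * B * Q"
    using similar_matD[OF assms] by blast
  hence c: "A \<in> carrier_mat n n" "B \<in> carrier_mat n n" "P \<in> carrier_mat n n" "Q \<in> carrier_mat n n"
    by auto
  show ?thesis
  proof (rule similar_matI)
    show "mstar st A = mstar st Q * mstar st B * mstar st P"
      unfolding A using c by (simp add: mstar_mult mult_mat_assoc)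
    show "mstar st Q * mstar st P = 1\<^sub>m n"
      using c by (simp add: PQ mstar_one flip: mstar_mult)
    show "mstar st P * mstar st Q = 1\<^sub>m n"
      using c by (simp add: QP mstar_one flip: mstar_mult)
  qed (use c in auto)
qed

text \<open>
  Up to a transposition, which leaves the characteristic polynomial unchanged, \<open>\<star>\<close> acts on a Jordan
  form by applying \<open>\<star>\<close> to the eigenvalues.
\<close>

lemma order_char_poly_mstar:
  assumes A: "A \<in> carrier_mat n n"
  shows "Polynomial.order (sstar st a) (char_poly (mstar st A)) = Polynomial.order a (char_poly A)"
proof -
  obtain as where "char_poly A = (\<Prod>a\<leftarrow>as. [:- a, 1:])"
    using char_poly_factorized[OF A] by auto
  from jordan_nf_exists[OF A this] obtain xs where xs: "jordan_nf A xs" ..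
  let ?ys = "map (\<lambda>(k, a). (k, sstar st a)) xs"
  have "char_poly (mstar st A) = char_poly (mstar st (jordan_matrix xs))"
    using xs by (intro char_poly_similar mstar_similar) (simp add: jordan_nf_def)
  also have "\<dots> = char_poly (jordan_matrix ?ys)"
    unfolding mstar_jordan_matrix by (rule char_poly_transpose_mat[OF jordan_matrix_carrier])
  finally have "char_poly (mstar st A) = char_poly (jordan_matrix ?ys)" .
  moreover have "jordan_nf (jordan_matrix ?ys) ?ys"
    using xs similar_mat_refl[OF jordan_matrix_carrier, of ?ys] by (force simp: jordan_nf_def)
  ultimately have "Polynomial.order (sstar st a) (char_poly (mstar st A))
      = sum_list (map fst (filter (\<lambda>x. snd x = sstar st a) ?ys))"
    by (simp only: jordan_nf_order)
  also have "\<dots> = sum_list (map fst (filter (\<lambda>x. snd x = a) xs))"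
    by (induction xs) (auto, (metis sstar_sstar)+)
  also have "\<dots> = Polynomial.order a (char_poly A)" by (rule jordan_nf_order[OF xs, symmetric])
  finally show ?thesis .
qed

lemma eigenvalue_iff_jordan_nf:
  fixes A :: "complex mat"
  assumes "A \<in> carrier_mat n n" "jordan_nf A xs"
  shows "eigenvalue A a \<longleftrightarrow> a \<in> snd ` set xs"
proof -
  have "0 \<notin> fst ` set xs" using assms(2) by (simp add: jordan_nf_def)
  hence "poly (\<Prod>(n, a)\<leftarrow>xs. [:- a, 1:] ^ n) a = 0 \<longleftrightarrow> a \<in> snd ` set xs"
    by (induction xs) auto
  thus ?thesis
    using eigenvalue_root_char_poly[OF assms(1)] jordan_nf_char_poly[OF assms(2)] by simp
qed

lemma star_pair_eq_iff: "star_pair st a = star_pair st b \<longleftrightarrow> a = b \<or> a = sstar st b"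
  unfolding star_pair_def by (metis doubleton_eq_iff sstar_sstar)

text \<open>
  Blocks in different groups belong to different pairs \<open>{\<mu>, \<mu>\<^sup>\<star>}\<close>, and such pairs are disjoint; this is
  the separation that \<open>block_diagonal_pal_system\<close> asks for.
\<close>

lemma star_grouped_jordan_form:
  fixes P :: "complex mat"
  assumes P: "jordan_nf P xs"
    and dist: "distinct (map (star_pair st) \<mu>s)"
    and cover: "star_pair st ` snd ` set xs \<subseteq> star_pair st ` set \<mu>s"
  defines "Ds \<equiv> map (\<lambda>\<mu>. jordan_matrix (filter (\<lambda>x. star_pair st (snd x) = star_pair st \<mu>) xs)) \<mu>s"
  shows "similar_mat P (diag_block_mat Ds)"
    and "\<forall>D \<in> set Ds. square_mat D \<and> upper_triangular D"
    and "sorted_wrt (\<lambda>D E. \<forall>a \<in> set (diag_mat D). \<forall>b \<in> set (diag_mat E). sstar st a \<noteq> b) Ds"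
proof -
  let ?grp = "\<lambda>\<mu>. filter (\<lambda>x. star_pair st (snd x) = star_pair st \<mu>) xs"
  have "(\<lambda>x. star_pair st (snd x)) ` set xs \<subseteq> set (map (star_pair st) \<mu>s)"
    using cover by auto
  from mset_concat_filter_partition[OF dist this]
  have "mset (concat (map ?grp \<mu>s)) = mset xs" by (simp add: comp_def)
  hence "similar_mat (jordan_matrix xs) (jordan_matrix (concat (map ?grp \<mu>s)))"
    by (intro similar_jordan_matrix_perm) simp
  moreover have "jordan_matrix (concat (map ?grp \<mu>s)) = diag_block_mat Ds"
    by (simp add: jordan_matrix_concat_diag_block_mat Ds_def comp_def)
  ultimately show "similar_mat P (diag_block_mat Ds)"
    using P similar_mat_trans unfolding jordan_nf_def by metis
  show "\<forall>D \<in> set Ds. square_mat D \<and> upper_triangular D"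
    by (auto simp: Ds_def jordan_matrix_upper_triangular')
  have "sstar st a \<noteq> b"
    if ij: "i < j" "j < length \<mu>s"
      and a: "a \<in> set (diag_mat (jordan_matrix (?grp (\<mu>s ! i))))"
      and b: "b \<in> set (diag_mat (jordan_matrix (?grp (\<mu>s ! j))))" for i j a b
  proof
    assume "sstar st a = b"
    hence "star_pair st a = star_pair st b" by (auto simp: star_pair_eq_iff)
    moreover have "star_pair st a = star_pair st (\<mu>s ! i)" "star_pair st b = star_pair st (\<mu>s ! j)"
      using subsetD[OF jordan_matrix_diag_set a] subsetD[OF jordan_matrix_diag_set b] by auto
    moreover have "star_pair st (\<mu>s ! i) \<noteq> star_pair st (\<mu>s ! j)"
      using dist ij by (auto simp: distinct_conv_nth)
    ultimately show False by simp
  qed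
  thus "sorted_wrt (\<lambda>D E. \<forall>a \<in> set (diag_mat D). \<forall>b \<in> set (diag_mat E). sstar st a \<noteq> b) Ds"
    unfolding sorted_wrt_iff_nth_less Ds_def by (auto simp del: jordan_matrix_dim)
qed

lemma jordan_nf_doubled:
  assumes "jordan_nf P xs" "similar_mat M (diag_block_mat [P, P])"
  shows "jordan_nf M (xs @ xs)"
  using jordan_nf_diag_block_mat[of "[(P, xs), (P, xs)]"] assms similar_mat_trans
  unfolding jordan_nf_def by auto

text \<open>
  In \<open>M\<close> each multiplicity of \<open>P\<close> is doubled. For \<open>\<mu> = \<mu>\<^sup>\<star>\<close> the halving in the definition undoes this. For
  \<open>\<mu> \<noteq> \<mu>\<^sup>\<star>\<close> the doubled multiplicity of \<open>\<mu>\<close> is the sum of the multiplicities of \<open>\<mu>\<close> and \<open>\<mu>\<^sup>\<star>\<close> in \<open>P\<close>, because they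
  are equal by the similarity of \<open>P\<close> and \<open>P\<^sup>\<star>\<close>.
\<close>

lemma zeta_part_eq_group_size:
  fixes P M :: "complex mat"
  assumes P: "P \<in> carrier_mat n n" "jordan_nf P xs"
    and sym: "similar_mat P (mstar st P)"
    and M: "similar_mat M (diag_block_mat [P, P])"
  shows "(if \<mu> \<noteq> sstar st \<mu> then Polynomial.order \<mu> (char_poly M) else Polynomial.order \<mu> (char_poly M) div 2)
    = sum_list (map fst (filter (\<lambda>x. star_pair st (snd x) = star_pair st \<mu>) xs))"
proof -
  note double_nf = jordan_nf_doubled[OF P(2) M]
  have double: "Polynomial.order \<mu> (char_poly M) = 2 * Polynomial.order \<mu> (char_poly P)"
    by (simp add: jordan_nf_order[OF P(2)] jordan_nf_order[OF double_nf])
  have "Polynomial.order (sstar st \<mu>) (char_poly P) = Polynomial.order \<mu> (char_poly P)"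
    using order_char_poly_mstar[OF P(1), of st \<mu>] char_poly_similar[OF sym] by simp
  show ?thesis
  proof (cases "\<mu> = sstar st \<mu>")
    case True
    hence "star_pair st (snd x) = star_pair st \<mu> \<longleftrightarrow> snd x = \<mu>" for x :: "nat \<times> complex"
      by (metis star_pair_eq_iff)
    thus ?thesis using True double by (simp add: jordan_nf_order[OF P(2)])
  next
    case False
    have "sum_list (map fst (filter (\<lambda>x. star_pair st (snd x) = star_pair st \<mu>) xs))
        = sum_list (map fst (filter (\<lambda>x. snd x = \<mu>) xs))
        + sum_list (map fst (filter (\<lambda>x. snd x = sstar st \<mu>) xs))"
      using False by (induction xs) (auto simp: star_pair_eq_iff)
    also have "\<dots> = Polynomial.order \<mu> (char_poly P) + Polynomial.order (sstar st \<mu>) (char_poly P)"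
      by (simp only: jordan_nf_order[OF P(2)])
    also have "\<dots> = Polynomial.order \<mu> (char_poly M)"
      using double \<open>Polynomial.order (sstar st \<mu>) (char_poly P) = Polynomial.order \<mu> (char_poly P)\<close> by simp
    finally show ?thesis using False by simp
  qed
qed

section \<open>The pair \<open>(X, J)\<close>\<close>

lemma jordan_data_mat_single_blocks:
  assumes "\<forall>(l, ks) \<in> set bs. length ks = 1"
  shows "jordan_data_mat bs = jordan_matrix (map (\<lambda>(l, ks). (hd ks, l)) bs)"
proof -
  have "eig_block l ks = jordan_block (hd ks) l" if len: "length ks = 1" for l and ks :: "nat list"
  proof -
    obtain k where "ks = [k]" using len by (auto simp: length_Suc_conv)
    thus ?thesis by (intro eq_matI) (auto simp: eig_block_def)
  qed
  hence "map (\<lambda>(l, ks). eig_block l ks) bs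
      = map (\<lambda>(k, a). jordan_block k a) (map (\<lambda>(l, ks). (hd ks, l)) bs)"
    using assms by auto
  thus ?thesis unfolding jordan_data_mat_def jordan_matrix_def by (simp only:)
qed

lemma invertible_jordan_matrix:
  fixes xs :: "(nat \<times> 'a :: field) list"
  assumes "0 \<notin> snd ` set xs"
  shows "invertible_mat (jordan_matrix xs)"
proof (rule invertible_matI[OF jordan_matrix_carrier])
  let ?n = "sum_list (map fst xs)"
  fix C :: "'a mat" assume C: "C \<in> carrier_mat ?n ?n" "jordan_matrix xs * C = 0\<^sub>m ?n ?n"
  show "C = 0\<^sub>m ?n ?n"
  proof (rule intertwiner_eq_zero[OF jordan_matrix_carrier zero_carrier_mat C(1), of "\<lambda>i. ?n - i"])
    fix i k assume "i < ?n" "k < ?n" "k \<noteq> i" "\<not> ?n - k < ?n - i"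
    thus "jordan_matrix xs $$ (i, k) = 0" by (intro jordan_matrix_upper_triangular) auto
  next
    fix i j assume "i < ?n" "j < ?n"
    thus "jordan_matrix xs $$ (i, i) \<noteq> (0\<^sub>m ?n ?n :: 'a mat) $$ (j, j)"
      using jordan_matrix_diag_mem[of i xs] assms by (metis index_zero_mat(1))
  qed (use C in \<open>auto intro: upper_triangularI\<close>)
qed

text \<open>
  The hypotheses on \<open>(X, J)\<close>, with the Jordan structure of \<open>J\<close> replaced by its two consequences: \<open>J\<close> is
  nonsingular and its commutant is commutative.
\<close>

locale palindromic_pair =
  fixes st :: star_op and \<epsilon> :: complex and n :: nat and X J :: "complex mat"
  assumes sign: "\<epsilon> \<in> {1, -1}"
    and X [simp]: "X \<in> carrier_mat n (2 * n)"
    and J [simp]: "J \<in> carrier_mat (2 * n) (2 * n)"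
    and invertible_J: "invertible_mat J"
    and invertible_rows: "invertible_mat (X @\<^sub>r (- (X * mat_inv J)))"
    and commutant_commutative: "\<And>A B. A \<in> carrier_mat (2 * n) (2 * n) \<Longrightarrow> J * A = A * J \<Longrightarrow>
      B \<in> carrier_mat (2 * n) (2 * n) \<Longrightarrow> J * B = B * J \<Longrightarrow> A * B = B * A"
begin

definition Z :: "complex mat" where "Z = X * mat_inv J"

lemma Ji [simp]: "mat_inv J \<in> carrier_mat (2 * n) (2 * n)"
  and J_Ji: "J * mat_inv J = 1\<^sub>m (2 * n)" and Ji_J: "mat_inv J * J = 1\<^sub>m (2 * n)"
  using mat_inv[OF J invertible_J] by auto

lemma Z [simp]: "Z \<in> carrier_mat n (2 * n)"
  unfolding Z_def by (rule mult_carrier_mat[OF X Ji])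

lemma dims [simp]:
  "dim_row X = n" "dim_col X = 2 * n" "dim_row J = 2 * n" "dim_col J = 2 * n"
  "dim_row (mat_inv J) = 2 * n" "dim_col (mat_inv J) = 2 * n"
  "dim_row Z = n" "dim_col Z = 2 * n"
  using X J Ji Z by (auto simp only: carrier_mat_def mem_Collect_eq)

lemma Z_J: "Z * J = X"
  by (simp add: Z_def mult_mat_assoc Ji_J right_mult_one_mat')

lemma sign_square: "\<epsilon> * \<epsilon> = 1" and sign_nonzero: "\<epsilon> \<noteq> 0"
  using sign by auto

lemma rows_carrier: "X @\<^sub>r (- Z) \<in> carrier_mat (2 * n) (2 * n)"
  using carrier_append_rows[OF X, of "- Z" n] Z by (simp only: mult_2 uminus_carrier_mat)

text \<open>
  This is the form in which the nonsingularity of the stacked matrix with rows \<open>X\<close> and \<open>- Z\<close> is used.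
\<close>

lemma rows_cancel:
  assumes T: "T \<in> carrier_mat (2 * n) k" and "X * T = 0\<^sub>m n k" "Z * T = 0\<^sub>m n k"
  shows "T = 0\<^sub>m (2 * n) k"
proof -
  let ?W = "X @\<^sub>r (- Z)"
  note W = rows_carrier
  note Wi = mat_inv[OF W invertible_rows[folded Z_def]]
  have "?W * T = (X * T) @\<^sub>r (- Z * T)"
    by (rule append_rows_mult[OF X uminus_carrier_mat[OF Z] T])
  also have "- Z * T = 0\<^sub>m n k"
    using T assms(3) by (simp add: uminus_mult_left_mat) (intro eq_matI; simp)
  also have "(X * T) @\<^sub>r 0\<^sub>m n k = 0\<^sub>m (2 * n) k"
    unfolding assms(2) append_rows_def by (intro eq_matI) auto
  finally have "mat_inv ?W * (?W * T) = 0\<^sub>m (2 * n) k"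
    using Wi(1) by simp
  moreover have "mat_inv ?W * (?W * T) = T"
    using T W Wi(1) by (simp add: Wi(3) flip: assoc_mult_mat[OF Wi(1) W T])
  ultimately show ?thesis by simp
qed

text \<open>
  The first \<open>n\<close> columns of the inverse of the stacked matrix.
\<close>

lemma X_right_inverse: obtains T where "T \<in> carrier_mat (2 * n) n" "X * T = 1\<^sub>m n"
proof -
  let ?W = "X @\<^sub>r (- Z)"
  note W = rows_carrier
  note Wi = mat_inv[OF W invertible_rows[folded Z_def]]
  let ?T = "mat (2 * n) n (\<lambda>ij. mat_inv ?W $$ ij)"
  have "X * ?T = 1\<^sub>m n"
  proof (rule eq_matI)
    fix i j assume "i < dim_row (1\<^sub>m n :: complex mat)" "j < dim_col (1\<^sub>m n :: complex mat)"
    hence ij: "i < n" "j < n" by auto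
    have "(X * ?T) $$ (i, j) = (\<Sum>k = 0..<2 * n. X $$ (i, k) * mat_inv ?W $$ (k, j))"
      using ij by (simp add: scalar_prod_def)
    also have "\<dots> = (?W * mat_inv ?W) $$ (i, j)"
      using ij W Wi(1) by (simp add: scalar_prod_def) (simp add: append_rows_def)
    finally show "(X * ?T) $$ (i, j) = 1\<^sub>m n $$ (i, j)"
      using ij by (simp add: Wi(2))
  qed auto
  thus ?thesis by (intro that[of ?T]) auto
qed

lemma S_JD:
  assumes "S \<in> S_J st \<epsilon> J"
  shows "S \<in> carrier_mat (2 * n) (2 * n)" "mstar st S = (- \<epsilon>) \<cdot>\<^sub>m S" "S = J * S * mstar st J"
  using assms by (auto simp: S_J_def)

lemma S_XJD:
  assumes "S \<in> S_XJ st \<epsilon> X J"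
  shows "S \<in> S_J st \<epsilon> J" "X * S * mstar st X = 0\<^sub>m n n"
  using assms by (auto simp: S_XJ_def)

text \<open>
  This moves every \<open>J\<^sup>\<star>\<close> to the other side of \<open>S\<close>, so that below only the moments \<open>X J\<^sup>k S X\<^sup>\<star>\<close> occur.
\<close>

lemma S_J_shift:
  assumes "S \<in> S_J st \<epsilon> J"
  shows "S * mstar st (mat_inv J) = J * S"
proof -
  note S = S_JD[OF assms]
  have "S * mstar st (mat_inv J) = J * S * mstar st J * mstar st (mat_inv J)"
    using S(3) by simp
  also have "\<dots> = J * S * mstar st (mat_inv J * J)"
    using S(1) by (simp add: mult_mat_assoc mstar_mult)
  also have "\<dots> = J * S"
    using S(1) by (simp add: Ji_J mstar_one)
  finally show ?thesis .
qed

lemma S_J_mstar_Z: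
  assumes "S \<in> S_J st \<epsilon> J"
  shows "S * mstar st Z = J * (S * mstar st X)"
proof -
  note S = S_JD[OF assms]
  have "S * mstar st Z = S * mstar st (mat_inv J) * mstar st X"
    using S(1) by (simp add: Z_def mstar_mult mult_mat_assoc)
  thus ?thesis
    unfolding S_J_shift[OF assms] using S(1) by (simp add: mult_mat_assoc)
qed

text \<open>
  The operation \<open>\<star>\<close> exchanges the moments with exponents \<open>k\<close> and \<open>-k\<close>, up to the factor \<open>-\<epsilon>\<close>. This and the next
  lemma are the cases \<open>k = -1\<close> and \<open>k = -2\<close>.
\<close>

lemma first_moment_mstar:
  assumes "S \<in> S_J st \<epsilon> J"
  shows "mstar st (Z * (S * mstar st X)) = (- \<epsilon>) \<cdot>\<^sub>m (X * (J * (S * mstar st X)))"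
proof -
  note S = S_JD[OF assms]
  have "mstar st (Z * (S * mstar st X)) = X * mstar st S * mstar st Z"
    using S(1) by (simp add: mstar_mult mult_mat_assoc)
  also have "\<dots> = (- \<epsilon>) \<cdot>\<^sub>m (X * (S * mstar st Z))"
    unfolding S(2) using S(1) by (simp add: mult_mat_assoc smult_mat_mult)
  finally show ?thesis unfolding S_J_mstar_Z[OF assms] .
qed

lemma second_moment_mstar:
  assumes "S \<in> S_J st \<epsilon> J"
  shows "mstar st (Z * (mat_inv J * (S * mstar st X)))
    = (- \<epsilon>) \<cdot>\<^sub>m (X * (J * (J * (S * mstar st X))))"
proof -
  note S = S_JD[OF assms]
  have "mstar st (Z * (mat_inv J * (S * mstar st X)))
      = X * mstar st S * mstar st (mat_inv J) * mstar st Z"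
    using S(1) by (simp add: mstar_mult mult_mat_assoc)
  also have "\<dots> = (- \<epsilon>) \<cdot>\<^sub>m (X * (S * mstar st (mat_inv J) * mstar st Z))"
    unfolding S(2) using S(1) by (simp add: mult_mat_assoc smult_mat_mult)
  also have "S * mstar st (mat_inv J) * mstar st Z = J * (S * mstar st Z)"
    unfolding S_J_shift[OF assms] using S(1) by (simp add: mult_mat_assoc)
  finally show ?thesis unfolding S_J_mstar_Z[OF assms] .
qed

text \<open>
  The columns of \<open>S X\<^sup>\<star>\<close> and \<open>J S X\<^sup>\<star> = S Z\<^sup>\<star>\<close> together span the whole space: up to sign they are \<open>S\<close> times \<open>\<star>\<close> of the
  stacked matrix.
\<close>

lemma moment_cancel:
  assumes S: "S \<in> S_J st \<epsilon> J" "invertible_mat S"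
    and Y: "Y \<in> carrier_mat k (2 * n)"
    and "Y * (S * mstar st X) = 0\<^sub>m k n" "Y * (J * (S * mstar st X)) = 0\<^sub>m k n"
  shows "Y = 0\<^sub>m k (2 * n)"
proof -
  note Sc = S_JD(1)[OF S(1)]
  note Si = mat_inv[OF Sc S(2)]
  let ?T = "mstar st (Y * S)"
  have "X * ?T = mstar st (Y * S * mstar st X)"
    using Y Sc by (simp add: mstar_mult mult_mat_assoc)
  also have "\<dots> = 0\<^sub>m n k"
    using Y Sc assms(4) by (simp add: mult_mat_assoc mstar_zero)
  finally have "X * ?T = 0\<^sub>m n k" .
  moreover have "Z * ?T = mstar st (Y * (S * mstar st Z))"
    using Y Sc by (simp add: mstar_mult mult_mat_assoc)
  hence "Z * ?T = 0\<^sub>m n k"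
    by (simp add: S_J_mstar_Z[OF S(1)] assms(5) mstar_zero)
  ultimately have "?T = 0\<^sub>m (2 * n) k"
    using Y Sc by (intro rows_cancel) auto
  hence YS: "Y * S = 0\<^sub>m k (2 * n)"
    by (metis mstar_mstar mstar_zero)
  have "Y = Y * S * mat_inv S"
    using Y Sc Si by (simp add: mult_mat_assoc)
  thus ?thesis unfolding YS using Si(1) by simp
qed

lemma moment_cancel_eq:
  assumes S: "S \<in> S_J st \<epsilon> J" "invertible_mat S"
    and Y: "Y \<in> carrier_mat k (2 * n)" "Y' \<in> carrier_mat k (2 * n)"
    and eq: "Y * (S * mstar st X) = Y' * (S * mstar st X)"
      "Y * (J * (S * mstar st X)) = Y' * (J * (S * mstar st X))"
  shows "Y = Y'"
proof -
  have V: "S * mstar st X \<in> carrier_mat (2 * n) n"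
    using S_JD(1)[OF S(1)] by simp
  have zero: "(Y - Y') * T = 0\<^sub>m k n"
    if "Y * T = Y' * T" "T \<in> carrier_mat (2 * n) n" for T
    using that Y by (simp add: minus_mult_distrib_mat[of _ k "2 * n" _ _ n])
  have "Y - Y' = 0\<^sub>m k (2 * n)"
    by (rule moment_cancel[OF S _ zero[OF eq(1) V] zero[OF eq(2) mult_carrier_mat[OF J V]]])
      (rule minus_carrier_mat[OF Y(2)])
  hence d: "(Y - Y') $$ (i, j) = 0" if "i < k" "j < 2 * n" for i j
    using that by simp
  show ?thesis
  proof (rule eq_matI)
    fix i j assume "i < dim_row Y'" "j < dim_col Y'"
    thus "Y $$ (i, j) = Y' $$ (i, j)" using d[of i j] Y by simp
  qed (use Y in auto)
qed

text \<open>
  If \<open>Z S X\<^sup>\<star> C = 0\<close>, then \<open>S X\<^sup>\<star> C\<close> is annihilated by \<open>Z\<close>, and by \<open>X\<close> since \<open>X S X\<^sup>\<star> = 0\<close>; hence it is zero, and \<open>C = 0\<close>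
  because \<open>X\<close> has full row rank.
\<close>

lemma invertible_first_moment:
  assumes S: "S \<in> S_XJ st \<epsilon> X J" "invertible_mat S"
  shows "invertible_mat (Z * (S * mstar st X))"
proof (rule invertible_matI)
  note SJ = S_XJD(1)[OF S(1)]
  note Sc = S_JD(1)[OF SJ]
  note Si = mat_inv[OF Sc S(2)]
  show "Z * (S * mstar st X) \<in> carrier_mat n n" using Sc by (auto intro!: carrier_matI)
  fix C assume C: "C \<in> carrier_mat n n" and zero: "Z * (S * mstar st X) * C = 0\<^sub>m n n"
  let ?T = "S * (mstar st X * C)"
  have "X * ?T = X * S * mstar st X * C"
    using Sc C by (simp add: mult_mat_assoc)
  hence "X * ?T = 0\<^sub>m n n" unfolding S_XJD(2)[OF S(1)] using C by simp
  moreover have "Z * ?T = 0\<^sub>m n n"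
    using zero Sc C by (simp add: mult_mat_assoc)
  ultimately have T0: "?T = 0\<^sub>m (2 * n) n"
    using Sc C by (intro rows_cancel) (auto intro!: carrier_matI)
  have "mat_inv S * ?T = mat_inv S * S * (mstar st X * C)"
    using Sc C Si(1) by (subst mult_mat_assoc) auto
  hence "mstar st X * C = mat_inv S * ?T"
    using C by (simp add: Si(3))
  hence XC: "mstar st X * C = 0\<^sub>m (2 * n) n"
    unfolding T0 using Si by simp
  obtain T where T: "T \<in> carrier_mat (2 * n) n" "X * T = 1\<^sub>m n" by (rule X_right_inverse)
  have "C = mstar st (X * T) * C"
    using C by (simp add: T(2) mstar_one)
  also have "\<dots> = mstar st T * (mstar st X * C)"
    using T(1) C by (simp add: mstar_mult mult_mat_assoc)
  finally show "C = 0\<^sub>m n n" unfolding XC using T(1) by simp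
qed

section \<open>The quotient of two solutions\<close>

lemma S_J_quotient_commutes:
  assumes S: "S \<in> S_J st \<epsilon> J" "invertible_mat S" and S': "S' \<in> S_J st \<epsilon> J"
  shows "J * (S' * mat_inv S) = S' * mat_inv S * J"
proof -
  note c = S_JD(1)[OF S(1)] S_JD(1)[OF S']
  note Si = mat_inv[OF c(1) S(2)]
  let ?H = "mstar st (mat_inv J)"
  have "mat_inv S * J = mat_inv S * (J * S) * mat_inv S"
    using c Si by (simp add: mult_mat_assoc)
  also have "\<dots> = mat_inv S * S * (?H * mat_inv S)"
    unfolding S_J_shift[OF S(1), symmetric] using c Si(1) by (simp add: mult_mat_assoc)
  also have "\<dots> = ?H * mat_inv S"
    unfolding Si(3) using Si(1) by simp
  finally have eq: "mat_inv S * J = ?H * mat_inv S" .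
  have "S' * mat_inv S * J = S' * ?H * mat_inv S"
    using c Si(1) eq by (simp add: mult_mat_assoc)
  also have "\<dots> = J * (S' * mat_inv S)"
    unfolding S_J_shift[OF S'] using c Si(1) by (simp add: mult_mat_assoc)
  finally show ?thesis ..
qed

lemma S_J_quotient_mstar:
  assumes S: "S \<in> S_J st \<epsilon> J" "invertible_mat S" and S': "S' \<in> S_J st \<epsilon> J"
  shows "S * mstar st (S' * mat_inv S) = S'"
proof -
  note c = S_JD(1)[OF S(1)] S_JD(1)[OF S']
  note Si = mat_inv[OF c(1) S(2)]
  let ?M = "S' * mat_inv S"
  have "?M * S = S'" using c Si by (simp add: mult_mat_assoc)
  hence "mstar st S * mstar st ?M = mstar st S'"
    using c Si(1) by (metis carrier_matD(1) carrier_matD(2) index_mult_mat(3) mstar_mult)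
  hence "(- \<epsilon>) \<cdot>\<^sub>m (S * mstar st ?M) = (- \<epsilon>) \<cdot>\<^sub>m S'"
    using c Si(1) by (simp add: S_JD(2)[OF S(1)] S_JD(2)[OF S'] smult_mat_mult)
  from smult_mat_cancel[OF _ this] show ?thesis using sign_nonzero by simp
qed

text \<open>
  The commutativity of the commutant is applied to \<open>S' S\<^sup>-\<^sup>1\<close> and \<open>R S\<^sup>-\<^sup>1\<close>; the rest is the observation that
  \<open>S (S' S\<^sup>-\<^sup>1)\<^sup>\<star> = S'\<close>.
\<close>

lemma S_J_intertwines:
  assumes S: "S \<in> S_J st \<epsilon> J" "invertible_mat S" and S': "S' \<in> S_J st \<epsilon> J" and R: "R \<in> S_J st \<epsilon> J"
  shows "S' * mat_inv S * R = R * mstar st (S' * mat_inv S)"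
proof -
  note c = S_JD(1)[OF S(1)] S_JD(1)[OF S'] S_JD(1)[OF R]
  note Si = mat_inv[OF c(1) S(2)]
  let ?M = "S' * mat_inv S" and ?N = "R * mat_inv S"
  have M: "?M \<in> carrier_mat (2 * n) (2 * n)" and N: "?N \<in> carrier_mat (2 * n) (2 * n)"
    using c Si(1) by auto
  have MN: "?M * ?N = ?N * ?M"
    by (rule commutant_commutative[OF M S_J_quotient_commutes[OF S S']
          N S_J_quotient_commutes[OF S R]])
  have NS: "?N * S = R" and MS: "?M * S = S'" using c Si by (simp_all add: mult_mat_assoc)
  have "R * mstar st ?M = ?N * (S * mstar st ?M)"
    unfolding assoc_mult_mat[symmetric, OF N c(1) mstar_carrier[OF M]] NS ..
  also have "\<dots> = ?N * (?M * S)"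
    unfolding S_J_quotient_mstar[OF S S'] MS ..
  also have "\<dots> = ?M * (?N * S)"
    using MN assoc_mult_mat[OF N M c(1)] assoc_mult_mat[OF M N c(1)] by simp
  finally show ?thesis unfolding NS ..
qed

lemma commutes_inverse:
  assumes A: "A \<in> carrier_mat (2 * n) (2 * n)" and comm: "J * A = A * J"
  shows "mat_inv J * A = A * mat_inv J"
proof -
  have "mat_inv J * A = mat_inv J * (A * J) * mat_inv J"
    using A by (simp add: mult_mat_assoc J_Ji)
  also have "\<dots> = mat_inv J * J * (A * mat_inv J)"
    unfolding comm[symmetric] using A by (simp add: mult_mat_assoc)
  also have "\<dots> = A * mat_inv J"
    unfolding Ji_J by (rule left_mult_one_mat[OF mult_carrier_mat[OF A Ji]])
  finally show ?thesis .
qed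

text \<open>
  Both \<open>X M\<close> and \<open>X\<close> annihilate the columns of \<open>S X\<^sup>\<star>\<close>, because \<open>M S = S'\<close> and \<open>X S' X\<^sup>\<star> = 0\<close>. On the
  complementary columns \<open>J S X\<^sup>\<star>\<close> the equation \<open>X M = P X\<close> determines \<open>P\<close>, as \<open>X J S X\<^sup>\<star>\<close> is nonsingular. The same \<open>P\<close> serves for \<open>Z = X J\<^sup>-\<^sup>1\<close> as \<open>M\<close>
  commutes with \<open>J\<close>.
\<close>

lemma quotient_acts_as_scalar_block:
  assumes S: "S \<in> S_XJ st \<epsilon> X J" "invertible_mat S" and S': "S' \<in> S_XJ st \<epsilon> X J"
  obtains P where "P \<in> carrier_mat n n"
    "X * (S' * mat_inv S) = P * X" "Z * (S' * mat_inv S) = P * Z"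
proof -
  note SJ = S_XJD(1)[OF S(1)] and SJ' = S_XJD(1)[OF S']
  note c = S_JD(1)[OF SJ] S_JD(1)[OF SJ']
  note Si = mat_inv[OF c(1) S(2)]
  let ?M = "S' * mat_inv S" and ?V = "S * mstar st X" and ?V' = "S' * mstar st X"
  have M: "?M \<in> carrier_mat (2 * n) (2 * n)" using c Si(1) by auto
  have V: "?V \<in> carrier_mat (2 * n) n" "?V' \<in> carrier_mat (2 * n) n" using c by auto
  have MV: "?M * ?V = ?V'"
  proof -
    have "?M * ?V = S' * (mat_inv S * S) * mstar st X"
      using c Si(1) by (simp add: mult_mat_assoc)
    thus ?thesis unfolding Si(3) using c by simp
  qed
  have comm: "J * ?M = ?M * J" by (rule S_J_quotient_commutes[OF SJ S(2) SJ'])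
  have XV: "X * ?V = 0\<^sub>m n n" "X * ?V' = 0\<^sub>m n n"
    using S_XJD(2)[OF S(1)] S_XJD(2)[OF S'] c by (simp_all add: mult_mat_assoc)
  let ?F = "X * (J * ?V)" and ?F' = "X * (J * ?V')"
  have F: "?F \<in> carrier_mat n n" "?F' \<in> carrier_mat n n"
    using c by (auto intro!: carrier_matI)
  have invF: "invertible_mat ((- \<epsilon>) \<cdot>\<^sub>m ?F)"
    using invertible_mat_mstar[OF mult_carrier_mat[OF Z V(1)] invertible_first_moment[OF S], of st]
    unfolding first_moment_mstar[OF SJ] .
  note Fi = mat_inv[OF smult_carrier_mat[OF F(1)] invF]
  \<comment> \<open>The factors \<open>-\<epsilon>\<close> cancel; they allow \<open>invertible_first_moment\<close> to be used through \<open>\<star>\<close>.\<close>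
  define P where "P = ((- \<epsilon>) \<cdot>\<^sub>m ?F') * mat_inv ((- \<epsilon>) \<cdot>\<^sub>m ?F)"
  have P: "P \<in> carrier_mat n n"
    unfolding P_def by (rule mult_carrier_mat[OF smult_carrier_mat[OF F(2)] Fi(1)])
  have "P * ((- \<epsilon>) \<cdot>\<^sub>m ?F) = (- \<epsilon>) \<cdot>\<^sub>m ?F'"
    unfolding P_def assoc_mult_mat[OF smult_carrier_mat[OF F(2)] Fi(1) smult_carrier_mat[OF F(1)]] Fi(3)
    by (rule right_mult_one_mat[OF smult_carrier_mat[OF F(2)]])
  hence "(- \<epsilon>) \<cdot>\<^sub>m (P * ?F) = (- \<epsilon>) \<cdot>\<^sub>m ?F'"
    unfolding mult_smult_distrib[OF P F(1)] .
  from smult_mat_cancel[OF _ this] have PF: "P * ?F = ?F'"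
    using sign_nonzero by simp
  have "X * ?M = P * X"
  proof (rule moment_cancel_eq[OF SJ S(2)])
    show "X * ?M * ?V = P * X * ?V"
      unfolding assoc_mult_mat[OF X M V(1)] assoc_mult_mat[OF P X V(1)] MV XV using P by simp
    have "X * ?M * (J * ?V) = X * (?M * J * ?V)"
      unfolding assoc_mult_mat[OF M J V(1)]
      by (rule assoc_mult_mat[OF X M mult_carrier_mat[OF J V(1)]])
    also have "\<dots> = ?F'"
      unfolding comm[symmetric] assoc_mult_mat[OF J M V(1)] MV ..
    also have "\<dots> = P * X * (J * ?V)"
      unfolding assoc_mult_mat[OF P X mult_carrier_mat[OF J V(1)]] PF ..
    finally show "X * ?M * (J * ?V) = P * X * (J * ?V)" .
  qed (use mult_carrier_mat[OF X M] mult_carrier_mat[OF P X] in auto)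
  moreover have "Z * ?M = P * Z"
  proof -
    have "mat_inv J * ?M = ?M * mat_inv J" by (rule commutes_inverse[OF M comm])
    hence "Z * ?M = X * ?M * mat_inv J"
      unfolding Z_def assoc_mult_mat[OF X Ji M] assoc_mult_mat[OF X M Ji] by simp
    thus ?thesis
      unfolding \<open>X * ?M = P * X\<close> Z_def assoc_mult_mat[OF P X Ji] .
  qed
  ultimately show ?thesis using that P by blast
qed

text \<open>
  The stacked matrix with rows \<open>X\<close> and \<open>- Z\<close> performs the similarity.
\<close>

lemma quotient_similar_doubled_block:
  assumes M: "M \<in> carrier_mat (2 * n) (2 * n)" and P: "P \<in> carrier_mat n n"
    and XM: "X * M = P * X" and ZM: "Z * M = P * Z"
  shows "similar_mat M (diag_block_mat [P, P])"
proof -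
  let ?W = "X @\<^sub>r (- Z)"
  note W = rows_carrier
  note Wi = mat_inv[OF W invertible_rows[folded Z_def]]
  let ?D = "four_block_mat P (0\<^sub>m n n) (0\<^sub>m n n) P"
  have D: "?D \<in> carrier_mat (2 * n) (2 * n)"
    unfolding mult_2 by (rule four_block_carrier_mat[OF P P])
  have D_eq: "diag_block_mat [P, P] = ?D" 
    by (simp only: diag_block_mat.simps(2)[of P "[P]"] diag_block_mat_singleton Let_def
        carrier_matD[OF P])
  have "?W * M = (X * M) @\<^sub>r (- Z * M)"
    by (rule append_rows_mult[OF X uminus_carrier_mat[OF Z] M])
  also have "- Z * M = P * (- Z)"
    using uminus_mult_left_mat[of Z M] uminus_mult_right_mat[of P Z] ZM M P by auto
  also have "(X * M) @\<^sub>r (P * (- Z)) = ?D * ?W"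
    unfolding XM by (rule four_block_mult_append_rows[OF P X uminus_carrier_mat[OF Z], symmetric])
  finally have WM: "?W * M = ?D * ?W" .
  have "M = mat_inv ?W * (?W * M)"
    unfolding assoc_mult_mat[OF Wi(1) W M, symmetric] Wi(3) using M by simp
  also have "\<dots> = mat_inv ?W * ?D * ?W"
    unfolding WM assoc_mult_mat[OF Wi(1) D W] ..
  finally show ?thesis
    unfolding D_eq using M D W Wi by (intro similar_matI[of _ _ _ _ "2 * n"]) auto
qed

text \<open>
  Multiplying \<open>M R = R M\<^sup>\<star>\<close> by \<open>X\<^sup>\<star>\<close> from the right gives \<open>M (R X\<^sup>\<star>) = (R X\<^sup>\<star>) P\<^sup>\<star>\<close>; it remains to multiply by \<open>Z\<close> or
  \<open>Z J\<^sup>-\<^sup>1\<close> from the left.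
\<close>

lemma quotient_block_intertwines:
  assumes S: "S \<in> S_J st \<epsilon> J" "invertible_mat S" and S': "S' \<in> S_J st \<epsilon> J"
    and R: "R \<in> S_J st \<epsilon> J"
    and P: "P \<in> carrier_mat n n"
      "X * (S' * mat_inv S) = P * X" "Z * (S' * mat_inv S) = P * Z"
  shows "P * (Z * (R * mstar st X)) = Z * (R * mstar st X) * mstar st P"
    and "P * (Z * (mat_inv J * (R * mstar st X)))
       = Z * (mat_inv J * (R * mstar st X)) * mstar st P"
proof -
  note c = S_JD(1)[OF S(1)] S_JD(1)[OF S'] S_JD(1)[OF R]
  note Si = mat_inv[OF c(1) S(2)]
  let ?M = "S' * mat_inv S" and ?V = "R * mstar st X"
  have M: "?M \<in> carrier_mat (2 * n) (2 * n)" using c Si(1) by auto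
  have V: "?V \<in> carrier_mat (2 * n) n" using c by auto
  have "?M * ?V = R * mstar st ?M * mstar st X"
    unfolding assoc_mult_mat[OF M c(3) mstar_carrier[OF X], symmetric]
      S_J_intertwines[OF S S' R] ..
  also have "\<dots> = R * mstar st (X * ?M)"
    using M c Si(1) by (simp add: mstar_mult mult_mat_assoc)
  also have "\<dots> = ?V * mstar st P"
    unfolding P(2) using P(1) c by (simp add: mstar_mult mult_mat_assoc)
  finally have MV: "?M * ?V = ?V * mstar st P" .
  show "P * (Z * ?V) = Z * ?V * mstar st P"
    unfolding assoc_mult_mat[OF P(1) Z V, symmetric] P(3)[symmetric]
      assoc_mult_mat[OF Z M V] MV assoc_mult_mat[OF Z V mstar_carrier[OF P(1)]] ..
  have comm: "J * ?M = ?M * J" by (rule S_J_quotient_commutes[OF S S'])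
  note comm' = commutes_inverse[OF M comm, symmetric]
  have JV: "mat_inv J * ?V \<in> carrier_mat (2 * n) n" by (rule mult_carrier_mat[OF Ji V])
  have "?M * (mat_inv J * ?V) = mat_inv J * ?V * mstar st P"
    unfolding assoc_mult_mat[OF M Ji V, symmetric] comm' assoc_mult_mat[OF Ji M V] MV
      assoc_mult_mat[OF Ji V mstar_carrier[OF P(1)]] ..
  thus "P * (Z * (mat_inv J * ?V)) = Z * (mat_inv J * ?V) * mstar st P"
    unfolding assoc_mult_mat[OF P(1) Z JV, symmetric] P(3)[symmetric]
      assoc_mult_mat[OF Z M JV] assoc_mult_mat[OF Z JV mstar_carrier[OF P(1)]] by (simp only:)
qed

section \<open>The systems attached to the solutions\<close>

text \<open>
  The symmetry of the middle coefficient. By \<open>moment_cancel\<close> there is a recurrence \<open>X J = C\<^sub>1 X + C\<^sub>2 Z\<close>. On the columns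
  \<open>R X\<^sup>\<star>\<close> and \<open>J R X\<^sup>\<star>\<close> it expresses \<open>C\<^sub>1\<close> and \<open>C\<^sub>2\<close> through \<open>B\<close>, \<open>G\<close> and their images under \<open>\<star>\<close>; evaluated on
  \<open>J\<^sup>-\<^sup>1 R X\<^sup>\<star>\<close>, where the left-hand side is \<open>X R X\<^sup>\<star> = 0\<close>, it becomes the assertion.
\<close>

lemma second_moment_symmetry:
  assumes R: "R \<in> S_XJ st \<epsilon> X J" "invertible_mat R"
  defines "B \<equiv> Z * (R * mstar st X)" and "G \<equiv> Z * (mat_inv J * (R * mstar st X))"
  shows "mstar st (mat_inv B * G * mat_inv B) = \<epsilon> \<cdot>\<^sub>m (mat_inv B * G * mat_inv B)"
proof -
  note RJ = S_XJD(1)[OF R(1)]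
  note c = S_JD(1)[OF RJ]
  let ?V = "R * mstar st X"
  have V: "?V \<in> carrier_mat (2 * n) n" using c by auto
  have JV: "J * ?V \<in> carrier_mat (2 * n) n" "mat_inv J * ?V \<in> carrier_mat (2 * n) n"
    using V by (auto intro: mult_carrier_mat[OF J] mult_carrier_mat[OF Ji])
  have B: "B \<in> carrier_mat n n" and G: "G \<in> carrier_mat n n"
    unfolding B_def G_def by (rule mult_carrier_mat[OF Z V] mult_carrier_mat[OF Z JV(2)])+
  have "invertible_mat B" unfolding B_def by (rule invertible_first_moment[OF R])
  note Bi = mat_inv[OF B this]
  have XV: "X * ?V = 0\<^sub>m n n"
    using S_XJD(2)[OF R(1)] c by (simp add: mult_mat_assoc)
  let ?s = "mstar st" and ?e = "- \<epsilon>"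
  note sB = mstar_carrier[OF B, of st] and sBi = mstar_carrier[OF Bi(1), of st]
    and sG = mstar_carrier[OF G, of st]
  have ee: "?e \<cdot>\<^sub>m (?e \<cdot>\<^sub>m A) = A" for A :: "complex mat"
    using sign_square by (intro eq_matI) (auto simp flip: mult.assoc)
  have F1: "X * (J * ?V) = ?e \<cdot>\<^sub>m ?s B"
    unfolding B_def first_moment_mstar[OF RJ] ee ..
  have F2: "X * (J * (J * ?V)) = ?e \<cdot>\<^sub>m ?s G"
    unfolding G_def second_moment_mstar[OF RJ] ee ..
  have sBiB: "?s Bi' * ?s B = 1\<^sub>m n" if "B * Bi' = 1\<^sub>m n" "Bi' \<in> carrier_mat n n" for Bi'
    using that B by (simp add: mstar_one flip: mstar_mult)
  note sBiB = sBiB[OF Bi(2) Bi(1)]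
  \<comment> \<open>The values forced by evaluating the recurrence on \<open>J R X\<^sup>\<star>\<close> and \<open>R X\<^sup>\<star>\<close>, respectively.\<close>
  define C1 where "C1 = ?s G * ?s (mat_inv B)"
  define C2 where "C2 = ?e \<cdot>\<^sub>m (?s B * mat_inv B)"
  have C: "C1 \<in> carrier_mat n n" "C2 \<in> carrier_mat n n"
    unfolding C1_def C2_def using sG sBi sB Bi(1) by (auto intro: mult_carrier_mat)
  have C1B: "C1 * ?s B = ?s G"
    unfolding C1_def assoc_mult_mat[OF sG sBi sB] sBiB by (rule right_mult_one_mat[OF sG])
  have C2B: "C2 * B = ?e \<cdot>\<^sub>m ?s B"
    unfolding C2_def mult_smult_assoc_mat[OF mult_carrier_mat[OF sB Bi(1)] B]
      assoc_mult_mat[OF sB Bi(1) B] Bi(3) right_mult_one_mat[OF sB] ..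
  have expand: "(C1 * X + C2 * Z) * T = C1 * (X * T) + C2 * (Z * T)"
    if T: "T \<in> carrier_mat (2 * n) n" for T
    using add_mult_distrib_mat[OF mult_carrier_mat[OF C(1) X] mult_carrier_mat[OF C(2) Z] T]
    unfolding assoc_mult_mat[OF C(1) X T] assoc_mult_mat[OF C(2) Z T] .
  have ZJV: "Z * (J * ?V) = X * ?V"
    unfolding assoc_mult_mat[OF Z J V, symmetric] Z_J ..
  have "X * J = C1 * X + C2 * Z"
  proof (rule moment_cancel_eq[OF RJ R(2)])
    show "X * J * ?V = (C1 * X + C2 * Z) * ?V"
      unfolding expand[OF V] XV assoc_mult_mat[OF X J V] F1 B_def[symmetric] C2B
      using C(1) sB by simp
    show "X * J * (J * ?V) = (C1 * X + C2 * Z) * (J * ?V)"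
      unfolding expand[OF JV(1)] ZJV XV assoc_mult_mat[OF X J JV(1)] F1 F2
        mult_smult_distrib[OF C(1) sB] C1B
      using C(2) sG by simp
  qed (use mult_carrier_mat[OF X J] mult_carrier_mat[OF C(1) X] mult_carrier_mat[OF C(2) Z] in auto)
  hence "X * J * (mat_inv J * ?V) = C1 * B + C2 * G"
    using expand[OF JV(2)]
    unfolding B_def G_def Z_def by (simp only: assoc_mult_mat[OF X Ji V])
  moreover have "X * J * (mat_inv J * ?V) = X * ?V"
    unfolding assoc_mult_mat[OF X J JV(2)] assoc_mult_mat[OF J Ji V, symmetric] J_Ji
      left_mult_one_mat[OF V] ..
  ultimately have zero: "C1 * B + C2 * G = 0\<^sub>m n n"
    unfolding XV by (simp only:)
  have "0\<^sub>m n n = ?s (mat_inv B) * (C1 * B + C2 * G) * mat_inv B"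
    unfolding zero using sBi Bi(1) by simp
  also have "\<dots> = ?s (mat_inv B) * (C1 * B) * mat_inv B + ?s (mat_inv B) * (C2 * G) * mat_inv B"
    using sBi Bi(1) C B G
    by (simp add: mult_add_distrib_mat[of _ n n _ n] add_mult_distrib_mat[of _ n n _ _ n]
        mult_carrier_mat[of _ n n _ n])
  also have "?s (mat_inv B) * (C1 * B) * mat_inv B
      = ?s (mat_inv B) * ?s G * ?s (mat_inv B) * (B * mat_inv B)"
    unfolding C1_def using G B Bi(1) by (simp add: mult_mat_assoc)
  also have "\<dots> = ?s (mat_inv B * G * mat_inv B)"
    unfolding Bi(2) using Bi(1) G by (simp add: mult_mat_assoc mstar_mult)
  also have "?s (mat_inv B) * (C2 * G) * mat_inv B
      = ?e \<cdot>\<^sub>m ((?s (mat_inv B) * ?s B) * (mat_inv B * G * mat_inv B))"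
    unfolding C2_def using B Bi(1) G by (simp add: mult_mat_assoc smult_mat_mult)
  also have "\<dots> = ?e \<cdot>\<^sub>m (mat_inv B * G * mat_inv B)"
    unfolding sBiB using Bi(1) G by (simp add: mult_carrier_mat[of _ n n _ n])
  finally have eq: "?s (mat_inv B * G * mat_inv B) + ?e \<cdot>\<^sub>m (mat_inv B * G * mat_inv B) = 0\<^sub>m n n" ..
  define T where "T = mat_inv B * G * mat_inv B"
  have T: "T \<in> carrier_mat n n"
    unfolding T_def using Bi(1) G by (simp add: mult_carrier_mat[of _ n n _ n])
  have "?s T = \<epsilon> \<cdot>\<^sub>m T"
  proof (rule eq_matI)
    fix i j assume "i < dim_row (\<epsilon> \<cdot>\<^sub>m T)" "j < dim_col (\<epsilon> \<cdot>\<^sub>m T)"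
    hence ij: "i < n" "j < n" using T by auto
    have "(?s T + ?e \<cdot>\<^sub>m T) $$ (i, j) = 0" using eq ij by (simp add: T_def)
    thus "?s T $$ (i, j) = (\<epsilon> \<cdot>\<^sub>m T) $$ (i, j)" using ij T by simp
  qed (use T in auto)
  thus ?thesis by (simp only: T_def)
qed

lemma hat_matrices:
  assumes R: "R \<in> S_XJ st \<epsilon> X J"
  defines "B \<equiv> Z * (R * mstar st X)" and "G \<equiv> Z * (mat_inv J * (R * mstar st X))"
  shows "B \<in> carrier_mat n n" "G \<in> carrier_mat n n"
    and "X * mat_inv J * R * mstar st X = B"
    and "A1_hat st \<epsilon> X J R = \<epsilon> \<cdot>\<^sub>m mat_inv B"
    and "invertible_mat R \<Longrightarrow> A0_hat st \<epsilon> X J R = - (mat_inv B * G * mat_inv B)"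
proof -
  note c = S_JD(1)[OF S_XJD(1)[OF R]]
  show B: "B \<in> carrier_mat n n" and G: "G \<in> carrier_mat n n"
    unfolding B_def G_def using c by (auto intro!: carrier_matI)
  show eq: "X * mat_inv J * R * mstar st X = B"
    unfolding B_def Z_def using c by (simp add: mult_mat_assoc)
  show A1: "A1_hat st \<epsilon> X J R = \<epsilon> \<cdot>\<^sub>m mat_inv B"
    unfolding A1_hat_def eq ..
  assume inv: "invertible_mat R"
  have "invertible_mat B" unfolding B_def by (rule invertible_first_moment[OF R inv])
  note Bi = mat_inv[OF B this]
  have sq: "mat_inv J ^\<^sub>m 2 = mat_inv J * mat_inv J"
    by (simp add: numeral_2_eq_2 left_mult_one_mat[OF Ji])
  have "A1_hat st \<epsilon> X J R * X * (mat_inv J ^\<^sub>m 2) * R * mstar st X * A1_hat st \<epsilon> X J R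
      = (\<epsilon> \<cdot>\<^sub>m mat_inv B) * G * (\<epsilon> \<cdot>\<^sub>m mat_inv B)"
    unfolding A1 sq G_def Z_def using Bi(1) c by (simp add: mult_mat_assoc)
  also have "\<dots> = (\<epsilon> * \<epsilon>) \<cdot>\<^sub>m (mat_inv B * G * mat_inv B)"
    using Bi(1) G by (simp add: smult_mat_mult) (intro eq_matI; simp)
  also have "\<dots> = mat_inv B * G * mat_inv B"
    unfolding sign_square by (intro eq_matI) auto
  finally show "A0_hat st \<epsilon> X J R = - (mat_inv B * G * mat_inv B)"
    by (simp add: A0_hat_def)
qed

lemma hat_system_regular:
  assumes R: "R \<in> S_XJ st \<epsilon> X J" "invertible_mat R"
  shows "invertible_mat (X * mat_inv J * R * mstar st X)"
    and "pal_coeffs st \<epsilon> n (A1_hat st \<epsilon> X J R) (A0_hat st \<epsilon> X J R)"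
    and "invertible_mat (A1_hat st \<epsilon> X J R)"
proof -
  let ?B = "Z * (R * mstar st X)" and ?G = "Z * (mat_inv J * (R * mstar st X))"
  note hat = hat_matrices[OF R(1)]
  have inv: "invertible_mat ?B" by (rule invertible_first_moment[OF R])
  note Bi = mat_inv[OF hat(1) inv]
  show "invertible_mat (X * mat_inv J * R * mstar st X)" unfolding hat(3) by (rule inv)
  have T: "mat_inv ?B * ?G * mat_inv ?B \<in> carrier_mat n n"
    by (rule mult_carrier_mat[OF mult_carrier_mat[OF Bi(1) hat(2)] Bi(1)])
  have "mstar st (- (mat_inv ?B * ?G * mat_inv ?B)) = - mstar st (mat_inv ?B * ?G * mat_inv ?B)"
    using T by (intro eq_matI) (auto simp: mstar_index, (cases st; simp)+)
  also have "\<dots> = \<epsilon> \<cdot>\<^sub>m (- (mat_inv ?B * ?G * mat_inv ?B))"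
    unfolding second_moment_symmetry[OF R] using T by (intro eq_matI) auto
  finally show "pal_coeffs st \<epsilon> n (A1_hat st \<epsilon> X J R) (A0_hat st \<epsilon> X J R)"
    unfolding pal_coeffs_def hat(4) hat(5)[OF R(2)]
    using smult_carrier_mat[OF Bi(1)] uminus_carrier_mat[OF T] by blast
  have "(\<epsilon> \<cdot>\<^sub>m mat_inv ?B) * (\<epsilon> \<cdot>\<^sub>m ?B) = (\<epsilon> * \<epsilon>) \<cdot>\<^sub>m (mat_inv ?B * ?B)"
    using Bi(1) hat(1) by (simp add: smult_mat_mult) (intro eq_matI; simp)
  also have "\<dots> = 1\<^sub>m n" unfolding Bi(3) sign_square by (intro eq_matI) auto
  finally show "invertible_mat (A1_hat st \<epsilon> X J R)"
    unfolding hat(4)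
    by (rule invertible_mat_right_inverseI[OF smult_carrier_mat[OF Bi(1)] smult_carrier_mat[OF hat(1)]])
qed

lemma hat_system_intertwines:
  assumes S: "S \<in> S_J st \<epsilon> J" "invertible_mat S" and S': "S' \<in> S_J st \<epsilon> J"
    and P: "P \<in> carrier_mat n n"
      "X * (S' * mat_inv S) = P * X" "Z * (S' * mat_inv S) = P * Z"
    and R: "R \<in> S_XJ st \<epsilon> X J" "invertible_mat R"
  shows "mstar st P * A1_hat st \<epsilon> X J R = A1_hat st \<epsilon> X J R * P"
    and "mstar st P * A0_hat st \<epsilon> X J R = A0_hat st \<epsilon> X J R * P"
proof -
  let ?B = "Z * (R * mstar st X)" and ?G = "Z * (mat_inv J * (R * mstar st X))"
  note hat = hat_matrices[OF R(1)]
  have inv: "invertible_mat ?B" by (rule invertible_first_moment[OF R])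
  define Bi where "Bi = mat_inv ?B"
  define G where "G = ?G"
  have Bi: "Bi \<in> carrier_mat n n" unfolding Bi_def by (rule mat_inv(1)[OF hat(1) inv])
  have G: "G \<in> carrier_mat n n" unfolding G_def by (rule hat(2))
  have sP: "mstar st P \<in> carrier_mat n n" using P(1) by simp
  note tw = quotient_block_intertwines[OF S S' S_XJD(1)[OF R(1)] P]
  have PBi: "mstar st P * Bi = Bi * P"
    unfolding Bi_def by (rule intertwiner_inverse[OF hat(1) inv P(1) sP tw(1)])
  have PG: "P * G = G * mstar st P" unfolding G_def by (rule tw(2))
  show "mstar st P * A1_hat st \<epsilon> X J R = A1_hat st \<epsilon> X J R * P"
    unfolding hat(4) Bi_def[symmetric] mult_smult_distrib[OF sP Bi] mult_smult_assoc_mat[OF Bi P(1)] PBi ..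
  have "mstar st P * (Bi * G * Bi) = mstar st P * Bi * (G * Bi)"
    using Bi G P(1) by (simp add: mult_mat_assoc)
  also have "\<dots> = Bi * (P * G) * Bi"
    unfolding PBi using Bi G P(1) by (simp add: mult_mat_assoc)
  also have "\<dots> = Bi * G * (mstar st P * Bi)"
    unfolding PG using Bi G P(1) by (simp add: mult_mat_assoc)
  also have "\<dots> = Bi * G * Bi * P"
    unfolding PBi using Bi G P(1) by (simp add: mult_mat_assoc)
  finally have eq: "mstar st P * (Bi * G * Bi) = Bi * G * Bi * P" .
  have T: "Bi * G * Bi \<in> carrier_mat n n" by (rule mult_carrier_mat[OF mult_carrier_mat[OF Bi G] Bi])
  have "mstar st P * (- (Bi * G * Bi)) = - (mstar st P * (Bi * G * Bi))"
    by (rule uminus_mult_right_mat) (simp only: carrier_matD[OF sP] carrier_matD[OF T])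
  also have "\<dots> = - (Bi * G * Bi) * P"
    unfolding eq
    by (rule uminus_mult_left_mat[symmetric]) (simp only: carrier_matD[OF P(1)] carrier_matD[OF T])
  finally show "mstar st P * A0_hat st \<epsilon> X J R = A0_hat st \<epsilon> X J R * P"
    unfolding hat(5)[OF R(2)] Bi_def G_def .
qed

end

section \<open>The common block diagonalization\<close>

text \<open>
  Distinct eigenvalues with one block each make the commutant commutative; nonzero eigenvalues make \<open>J\<close>
  nonsingular.
\<close>

lemma palindromic_pairI:
  assumes "\<epsilon> \<in> {1, -1}" "X \<in> carrier_mat n (2 * n)"
    and data: "pjcf_data st n bs" and J: "J = jordan_data_mat bs"
    and rows: "invertible_mat (X @\<^sub>r (- (X * mat_inv J)))"
    and single: "\<forall>(l, ks) \<in> set bs. length ks = 1"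
  shows "palindromic_pair \<epsilon> n X J"
proof
  let ?xs = "map (\<lambda>(l, ks). (hd ks, l)) bs"
  have JM: "J = jordan_matrix ?xs"
    unfolding J by (rule jordan_data_mat_single_blocks[OF single])
  have "map fst ?xs = map (\<lambda>(l, ks). sum_list ks) bs"
    using single by (auto simp: length_Suc_conv)
  moreover have "(\<Sum>(l, ks)\<leftarrow>bs. sum_list ks) = 2 * n"
    using data unfolding pjcf_data_def by blast
  ultimately have dim: "sum_list (map fst ?xs) = 2 * n" by (simp only:)
  have eigs: "map snd ?xs = map fst bs" by auto
  show "J \<in> carrier_mat (2 * n) (2 * n)"
    unfolding JM dim[symmetric] by (rule jordan_matrix_carrier)
  have "distinct (map fst bs)" "0 \<notin> fst ` set bs"
    using data unfolding pjcf_data_def by blast+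
  hence dist: "distinct (map snd ?xs)" and "0 \<notin> snd ` set ?xs"
    unfolding set_map[symmetric] eigs by auto
  from this(2) show "invertible_mat J" unfolding JM by (rule invertible_jordan_matrix)
  fix A B :: "complex mat"
  assume "A \<in> carrier_mat (2 * n) (2 * n)" "J * A = A * J"
    "B \<in> carrier_mat (2 * n) (2 * n)" "J * B = B * J"
  thus "A * B = B * A"
    unfolding JM dim[symmetric]
    by (rule commutant_jordan_matrix_commutative[OF dist])
qed (use assms in auto)

theorem theorem3p2:
  fixes st :: star_op and \<epsilon> :: complex and n :: nat
    and X J S S' :: "complex mat" and bs :: jordan_data and ns :: "nat list"
  assumes "\<epsilon> \<in> {1, -1}"
    and "X \<in> carrier_mat n (2 * n)"
    and "pjcf_data st n bs" and "J = jordan_data_mat bs"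
    and "invertible_mat (X @\<^sub>r (- (X * mat_inv J)))"
    and geometric_multiplicity_one: "\<forall>(l, ks) \<in> set bs. length ks = 1"
    and "S \<in> S_XJ st \<epsilon> X J" and "invertible_mat S"
    and "S' \<in> S_XJ st \<epsilon> X J" and "invertible_mat S'"
    and "zeta_listing st (S' * mat_inv S) ns"
  shows "\<exists>K. K \<in> carrier_mat n n \<and> invertible_mat K \<and>
    (\<forall>S_hat \<in> S_XJ st \<epsilon> X J. invertible_mat S_hat \<longrightarrow>
       (let A1 = A1_hat st \<epsilon> X J S_hat; A0 = A0_hat st \<epsilon> X J S_hat in
          invertible_mat (X * mat_inv J * S_hat * mstar st X) \<and>
          pal_coeffs st \<epsilon> n A1 A0 \<and> invertible_mat A1 \<and>
          (\<exists>Qs. length Qs = length ns \<and>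
             (\<forall>i < length ns. regular_pal_system st \<epsilon> (ns ! i) (Qs ! i)) \<and>
             (\<forall>z. mstar st K * pal_poly st \<epsilon> A1 A0 z * K = diag_block_mat (map (\<lambda>Q. Q z) Qs)))))"
proof -
  interpret palindromic_pair st \<epsilon> n X J
    by (rule palindromic_pairI[OF assms(1-6)])
  note S = assms(7,8) and S' = assms(9)
  note SJ = S_XJD(1)[OF S(1)] and SJ' = S_XJD(1)[OF S']
  let ?M = "S' * mat_inv S"
  have Si: "mat_inv S \<in> carrier_mat (2 * n) (2 * n)"
    by (rule mat_inv(1)[OF S_JD(1)[OF SJ] S(2)])
  have M: "?M \<in> carrier_mat (2 * n) (2 * n)"
    by (rule mult_carrier_mat[OF S_JD(1)[OF SJ'] Si])
  obtain P where P: "P \<in> carrier_mat n n" "X * ?M = P * X" "Z * ?M = P * Z"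
    by (rule quotient_acts_as_scalar_block[OF S S'])
  have sim: "similar_mat ?M (diag_block_mat [P, P])"
    by (rule quotient_similar_doubled_block[OF M P])
  obtain as where "char_poly P = (\<Prod>a\<leftarrow>as. [:- a, 1:])"
    using char_poly_factorized[OF P(1)] by auto
  from jordan_nf_exists[OF P(1) this] obtain xs where xs: "jordan_nf P xs" ..
  have B: "Z * (S * mstar st X) \<in> carrier_mat n n" by (rule hat_matrices(1)[OF S(1)])
  have sP: "mstar st P \<in> carrier_mat n n" using P(1) by simp
  note Bi = mat_inv[OF B invertible_first_moment[OF S]]
  note tw = quotient_block_intertwines(1)[OF SJ S(2) SJ' SJ P]
  \<comment> \<open>The intertwining relation for \<open>R = S\<close>.\<close>
  have "similar_mat P (mstar st P)"
  proof (rule similar_matI)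
    show "P = Z * (S * mstar st X) * mstar st P * mat_inv (Z * (S * mstar st X))"
      unfolding tw[symmetric] assoc_mult_mat[OF P(1) B Bi(1)] Bi(2) right_mult_one_mat[OF P(1)] ..
  qed (use P(1) sP B Bi in auto)
  note size = zeta_part_eq_group_size[OF P(1) xs this sim]
  obtain \<mu>s where \<mu>s: "distinct (map (star_pair st) \<mu>s)"
      "star_pair st ` set \<mu>s = star_pair st ` Collect (eigenvalue ?M)"
    and ns: "ns = map (\<lambda>\<mu>. if \<mu> \<noteq> sstar st \<mu> then Polynomial.order \<mu> (char_poly ?M)
                          else Polynomial.order \<mu> (char_poly ?M) div 2) \<mu>s"
    using assms(11) unfolding zeta_listing_def by blast
  have "eigenvalue ?M a \<longleftrightarrow> a \<in> snd ` set xs" for a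
    using eigenvalue_iff_jordan_nf[OF M jordan_nf_doubled[OF xs sim], of a] by simp
  hence "Collect (eigenvalue ?M) = snd ` set xs" by blast
  hence cover: "star_pair st ` snd ` set xs \<subseteq> star_pair st ` set \<mu>s" using \<mu>s(2) by simp
  define Ds where "Ds = map (\<lambda>\<mu>. jordan_matrix (filter (\<lambda>x. star_pair st (snd x) = star_pair st \<mu>) xs)) \<mu>s"
  note Ds = star_grouped_jordan_form[OF xs \<mu>s(1) cover, folded Ds_def]
  have len: "length Ds = length ns" by (simp add: Ds_def ns)
  have dimD: "dim_row (Ds ! i) = ns ! i" if "i < length ns" for i
    using that size by (simp add: Ds_def ns)
  define D where "D = diag_block_mat Ds"
  obtain K L where "similar_mat_wit P D K L"
    using Ds(1) unfolding similar_mat_def D_def by blast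
  from similar_mat_witD2[OF P(1) this]
  have KL: "K * L = 1\<^sub>m n" "L * K = 1\<^sub>m n" "P = K * D * L" and c: "D \<in> carrier_mat n n"
    "K \<in> carrier_mat n n" "L \<in> carrier_mat n n" by auto
  have PK: "P * K = K * D"
    unfolding KL(3) assoc_mult_mat[OF mult_carrier_mat[OF c(2,1)] c(3,2)] KL(2)
    by (rule right_mult_one_mat[OF mult_carrier_mat[OF c(2,1)]])
  have K: "invertible_mat K" by (rule invertible_mat_right_inverseI[OF c(2,3) KL(1)])
  note sK = mstar_carrier[OF c(2), of st]
  have transfer: "mstar st D * (mstar st K * A * K) = mstar st K * A * K * D"
    if A: "A \<in> carrier_mat n n" "mstar st P * A = A * P" for A
  proof -
    have "mstar st D * (mstar st K * A * K) = mstar st (K * D) * A * K"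
      using c A(1) by (simp add: mstar_mult mult_mat_assoc)
    also have "\<dots> = mstar st K * (mstar st P * A) * K"
      unfolding PK[symmetric] using c A(1) P(1) by (simp add: mstar_mult mult_mat_assoc)
    also have "\<dots> = mstar st K * A * (P * K)"
      unfolding A(2) using c A(1) P(1) by (simp add: mult_mat_assoc)
    also have "\<dots> = mstar st K * A * K * D"
      unfolding PK using c A(1) by (simp add: mult_mat_assoc)
    finally show ?thesis .
  qed
  have main: "invertible_mat (X * mat_inv J * R * mstar st X) \<and>
      pal_coeffs st \<epsilon> n (A1_hat st \<epsilon> X J R) (A0_hat st \<epsilon> X J R) \<and>
      invertible_mat (A1_hat st \<epsilon> X J R) \<and>
      (\<exists>Qs. length Qs = length ns \<and>
        (\<forall>i < length ns. regular_pal_system st \<epsilon> (ns ! i) (Qs ! i)) \<and>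
        (\<forall>z. mstar st K * pal_poly st \<epsilon> (A1_hat st \<epsilon> X J R) (A0_hat st \<epsilon> X J R) z * K
           = diag_block_mat (map (\<lambda>Q. Q z) Qs)))"
    if R: "R \<in> S_XJ st \<epsilon> X J" "invertible_mat R" for R
  proof -
    let ?A1 = "A1_hat st \<epsilon> X J R" and ?A0 = "A0_hat st \<epsilon> X J R"
    note reg = hat_system_regular[OF R]
    have A: "?A1 \<in> carrier_mat n n" "?A0 \<in> carrier_mat n n"
      using reg(2) by (auto simp: pal_coeffs_def)
    note tw = hat_system_intertwines[OF SJ S(2) SJ' P R]
    have "dim_row (diag_block_mat Ds) = n" using c(1) by (simp add: D_def)
    hence "pal_coeffs st \<epsilon> (dim_row (diag_block_mat Ds)) (mstar st K * ?A1 * K) (mstar st K * ?A0 * K)"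
      using pal_coeffs_congruence[OF reg(2) c(2)] by simp
    moreover have "invertible_mat (mstar st K * ?A1 * K)"
      by (intro invertible_mat_mult[of _ n] mult_carrier_mat[OF sK A(1)] sK A(1) c(2) K reg(3)
          invertible_mat_mstar[OF c(2) K])
    ultimately have "\<exists>Qs. length Qs = length Ds \<and>
      (\<forall>i < length Ds. regular_pal_system st \<epsilon> (dim_row (Ds ! i)) (Qs ! i)) \<and>
      (\<forall>z. pal_poly st \<epsilon> (mstar st K * ?A1 * K) (mstar st K * ?A0 * K) z
         = diag_block_mat (map (\<lambda>Q. Q z) Qs))"
      by (rule block_diagonal_pal_system[OF Ds(2,3) _ _
            transfer[OF A(1) tw(1), unfolded D_def] transfer[OF A(2) tw(2), unfolded D_def]])
    thus ?thesis
      unfolding pal_poly_congruence[OF A c(2)] using reg len dimD by auto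
  qed
  show ?thesis
    unfolding Let_def using c(2) K main by blast
qed

end
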